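(* Let $0<\upsilon<\kappa<\gamma$ and let $P,\Upsilon,\Gamma\in C^1(X,\mathbb{R})$ be weakly lower semicontinuous and $\kappa$-homogeneous, $\upsilon$-homogeneous and $\gamma$-homogeneous, respectively. Assume there exists $C>0$ such that $P(u)\geq C^{-1}\|u\|^{\kappa}$, $|\Upsilon(u)|\leq C\|u\|^{\upsilon}$ and $|\Gamma(u)|\leq C\|u\|^{\gamma}$ for all $u\in X$. Let $\Phi(u)=\frac{1}{\kappa}P(u)+\frac{1}{\upsilon}\Upsilon(u)+\frac{1}{\gamma}\Gamma(u)$, $J(u)=\Phi'(u)u=P(u)+\Upsilon(u)+\Gamma(u)$, $Y_1=\{u\in X:\Upsilon(u)<0\}$ and $Y_2=\{u\in X:\Gamma(u)<0\}$. Assume that for $Y=Y_1$ and for $Y=Y_2$ the following holds: if $(u_n)\subset Y$, $u_n\rightharpoonup u$ in $X$ and $J(u_n)\to J(u)$, then $u_n\to u$ in $X$. Assume also that for any $u\in Y_1\cap Y_2$ the map $\varphi_u(t)=\Phi(tu)$, $t>0$, has exactly two critical points $0<t_u<s_u$, both non-degenerate, with $t_u$ a local minimum point and $s_u$ a local maximum point. If $Y_1$ is nonempty, then $c:=\inf_{\mathcal{N}\cap Y_1}\Phi<0$ is the ground state level of $\Phi$, and it is achieved by a local minimizer of $\Phi$. If, in addition, $Y_2$ is nonempty, then $\Phi$ has a second nontrivial critical point.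
   Context: $X$ is a reflexive Banach space. A functional $H$ is $\theta$-homogeneous if $H(tu)=t^{\theta}H(u)$ for any $t>0$ and $u\in X$. $\mathcal{N}=\{u\in X\setminus\{0\}:\Phi'(u)u=0\}$. A critical point $t$ of $\varphi_u$ is non-degenerate if $\varphi_u''(t)\neq 0$. Strong and weak convergence are denoted by $\to$ and $\rightharpoonup$. A ground state is a nontrivial critical point of $\Phi$ minimizing $\Phi$ over the set of all nontrivial critical points; a number is the ground state level of $\Phi$ if it is the value of $\Phi$ at a ground state. *)

theory Defs
  imports "HOL-Analysis.Analysis"
begin

definition reflexive_space :: "'a::real_normed_vector itself \<Rightarrow> bool" where
  "reflexive_space _ \<longleftrightarrow>
     (\<forall>\<Xi> :: ('a \<Rightarrow>\<^sub>L real) \<Rightarrow>\<^sub>L real. \<exists>x::'a. \<forall>f. blinfun_apply \<Xi> f = blinfun_apply f x)"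

definition weakly_converges :: "(nat \<Rightarrow> 'a::real_normed_vector) \<Rightarrow> 'a \<Rightarrow> bool" where
  "weakly_converges x u \<longleftrightarrow>
     (\<forall>f :: 'a \<Rightarrow>\<^sub>L real. (\<lambda>n. blinfun_apply f (x n)) \<longlonglongrightarrow> blinfun_apply f u)"

text \<open>Weak lower semicontinuity is taken in the sequential sense.  As a hypothesis this is no
  stronger than lower semicontinuity for the weak topology.\<close>

definition weakly_lsc :: "('a::real_normed_vector \<Rightarrow> real) \<Rightarrow> bool" where
  "weakly_lsc H \<longleftrightarrow>
     (\<forall>x u. weakly_converges x u \<longrightarrow> ereal (H u) \<le> liminf (\<lambda>n. ereal (H (x n))))"

definition C1_functional :: "('a::real_normed_vector \<Rightarrow> real) \<Rightarrow> bool" where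
  "C1_functional H \<longleftrightarrow>
     (\<exists>H' :: 'a \<Rightarrow> 'a \<Rightarrow>\<^sub>L real.
        (\<forall>u. (H has_derivative blinfun_apply (H' u)) (at u)) \<and> continuous_on UNIV H')"

definition homogeneous :: "real \<Rightarrow> ('a::real_vector \<Rightarrow> real) \<Rightarrow> bool" where
  "homogeneous \<theta> H \<longleftrightarrow> (\<forall>t>0. \<forall>u. H (t *\<^sub>R u) = t powr \<theta> * H u)"

definition radial_derivative :: "('a::real_normed_vector \<Rightarrow> real) \<Rightarrow> 'a \<Rightarrow> real" where
  "radial_derivative F u = frechet_derivative F (at u) u"

definition nehari :: "('a::real_normed_vector \<Rightarrow> real) \<Rightarrow> 'a set" where
  "nehari F = {u. u \<noteq> 0 \<and> radial_derivative F u = 0}"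

definition critical_point :: "('a::real_normed_vector \<Rightarrow> real) \<Rightarrow> 'a \<Rightarrow> bool" where
  "critical_point F u \<longleftrightarrow> (F has_derivative (\<lambda>_. 0)) (at u)"

definition ground_state :: "('a::real_normed_vector \<Rightarrow> real) \<Rightarrow> 'a \<Rightarrow> bool" where
  "ground_state F u \<longleftrightarrow> u \<noteq> 0 \<and> critical_point F u \<and>
     (\<forall>v. v \<noteq> 0 \<and> critical_point F v \<longrightarrow> F u \<le> F v)"

definition ground_state_level :: "('a::real_normed_vector \<Rightarrow> real) \<Rightarrow> real \<Rightarrow> bool" where
  "ground_state_level F c \<longleftrightarrow> (\<exists>u. ground_state F u \<and> F u = c)"

definition local_minimizer :: "('a::topological_space \<Rightarrow> real) \<Rightarrow> 'a \<Rightarrow> bool" where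
  "local_minimizer F u \<longleftrightarrow> (\<forall>\<^sub>F v in nhds u. F u \<le> F v)"

definition local_maximizer :: "('a::topological_space \<Rightarrow> real) \<Rightarrow> 'a \<Rightarrow> bool" where
  "local_maximizer F u \<longleftrightarrow> (\<forall>\<^sub>F v in nhds u. F v \<le> F u)"

definition nondegenerate :: "(real \<Rightarrow> real) \<Rightarrow> real \<Rightarrow> bool" where
  "nondegenerate \<phi> t \<longleftrightarrow> deriv (deriv \<phi>) t \<noteq> 0"

text \<open>Euler's identity: for \<open>\<Phi> = P / \<kappa> + \<Upsilon> / \<upsilon> + \<Gamma> / \<gamma>\<close> it gives
  \<open>radial_derivative \<Phi> u = P u + \<Upsilon> u + \<Gamma> u\<close>.\<close>

lemma radial_derivative_homogeneous:
  assumes hom: "homogeneous \<theta> H" and diff: "H differentiable at u"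
  shows "radial_derivative H u = \<theta> * H u"
proof -
  have D: "(H has_derivative frechet_derivative H (at u)) (at u)"
    using diff by (simp add: frechet_derivative_works)
  then have lin: "linear (frechet_derivative H (at u))"
    by (rule has_derivative_linear)
  have "((\<lambda>t. t *\<^sub>R u) has_derivative (\<lambda>h. h *\<^sub>R u)) (at (1::real))"
    by (auto intro!: derivative_eq_intros)
  then have "((\<lambda>t. H (t *\<^sub>R u)) has_derivative
      (\<lambda>h. frechet_derivative H (at u) (h *\<^sub>R u))) (at 1)"
    using has_derivative_compose[of "\<lambda>t. t *\<^sub>R u" _ 1 UNIV H] D by simp
  then have 1: "((\<lambda>t. H (t *\<^sub>R u)) has_real_derivative frechet_derivative H (at u) u) (at 1)"
    by (simp add: has_field_derivative_def linear_cmul[OF lin] mult_commute_abs)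
  have "((\<lambda>t. t powr \<theta> * H u) has_real_derivative \<theta> * H u) (at 1)"
    by (auto intro!: derivative_eq_intros)
  moreover have "\<forall>\<^sub>F t in nhds (1::real). t > 0"
    by (rule eventually_nhds_in_open[of "{0<..}", simplified]) auto
  then have "\<forall>\<^sub>F t in nhds 1. H (t *\<^sub>R u) = t powr \<theta> * H u"
    by eventually_elim (use hom in \<open>auto simp: homogeneous_def\<close>)
  ultimately have "((\<lambda>t. H (t *\<^sub>R u)) has_real_derivative \<theta> * H u) (at 1)"
    by (simp cong: DERIV_cong_ev)
  with 1 show ?thesis
    unfolding radial_derivative_def by (rule DERIV_unique)
qed

lemma radial_derivative_sum:
  fixes P \<Upsilon> \<Gamma> :: "'a::real_normed_vector \<Rightarrow> real"
  assumes "\<kappa> \<noteq> 0" "\<upsilon> \<noteq> 0" "\<gamma> \<noteq> 0"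
    and "C1_functional P" "C1_functional \<Upsilon>" "C1_functional \<Gamma>"
    and "homogeneous \<kappa> P" "homogeneous \<upsilon> \<Upsilon>" "homogeneous \<gamma> \<Gamma>"
  shows "radial_derivative (\<lambda>u. 1/\<kappa> * P u + 1/\<upsilon> * \<Upsilon> u + 1/\<gamma> * \<Gamma> u) u = P u + \<Upsilon> u + \<Gamma> u"
proof -
  let ?D = "\<lambda>H::'a \<Rightarrow> real. frechet_derivative H (at u)"
  have d: "P differentiable at u" "\<Upsilon> differentiable at u" "\<Gamma> differentiable at u"
    using assms unfolding C1_functional_def differentiable_def by blast+
  have "(P has_derivative ?D P) (at u)" "(\<Upsilon> has_derivative ?D \<Upsilon>) (at u)"
    "(\<Gamma> has_derivative ?D \<Gamma>) (at u)"
    using d by (simp_all add: frechet_derivative_works)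
  then have "((\<lambda>u. 1/\<kappa> * P u + 1/\<upsilon> * \<Upsilon> u + 1/\<gamma> * \<Gamma> u) has_derivative
      (\<lambda>h. 1/\<kappa> * ?D P h + 1/\<upsilon> * ?D \<Upsilon> h + 1/\<gamma> * ?D \<Gamma> h)) (at u)"
    by (intro has_derivative_add has_derivative_mult_right)
  then have "?D (\<lambda>u. 1/\<kappa> * P u + 1/\<upsilon> * \<Upsilon> u + 1/\<gamma> * \<Gamma> u) =
      (\<lambda>h. 1/\<kappa> * ?D P h + 1/\<upsilon> * ?D \<Upsilon> h + 1/\<gamma> * ?D \<Gamma> h)"
    by (rule frechet_derivative_at[symmetric])
  moreover have "?D P u = \<kappa> * P u" "?D \<Upsilon> u = \<upsilon> * \<Upsilon> u" "?D \<Gamma> u = \<gamma> * \<Gamma> u"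
    using d assms radial_derivative_homogeneous unfolding radial_derivative_def by blast+
  ultimately show ?thesis
    using assms(1-3) by (simp add: radial_derivative_def)
qed

end

theory Submission
  imports Defs "HOL-Complex_Analysis.Great_Picard"
begin

text \<open>
  On the ray through \<open>u \<noteq> 0\<close> one has
  \<open>J (t u) = t\<^sup>\<upsilon> (\<Upsilon> u + P u t\<^sup>\<kappa>\<^sup>-\<^sup>\<upsilon> + \<Gamma> u t\<^sup>\<gamma>\<^sup>-\<^sup>\<upsilon>)\<close>, and \<open>t \<mapsto> \<Phi> (t u)\<close> has derivative
  \<open>J (t u) / t\<close>.  The bracket is strictly quasi-concave because \<open>P u > 0\<close>
  (\<open>powr_sum_quasi_concave\<close>), and it is positive somewhere (\<open>J_ray_pos\<close>; when \<open>\<Upsilon> u\<close> and \<open>\<Gamma> u\<close> are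
  both negative this is what the two critical points of the fibering map give).  So \<open>J\<close> is positive
  on exactly one interval of each ray; \<open>\<Phi>\<close> decreases before that interval, increases on it and
  decreases after it.  On the set \<open>J = 0\<close> the term \<open>\<Gamma>\<close> can be eliminated, which writes \<open>\<Phi>\<close> there as
  a coercive functional \<open>E\<close> in \<open>P\<close> and \<open>\<Upsilon>\<close>; hence minimizing sequences of \<open>\<Phi>\<close> in subsets of
  \<open>J = 0\<close> are bounded and, by reflexivity, have weakly convergent subsequences.

  Ground state (\<open>ground_state_minimizer\<close>).  Minimize \<open>\<Phi>\<close> over the left end points: \<open>J u = 0\<close>,
  \<open>\<Upsilon> u < 0\<close> and \<open>J (r u) \<le> 0\<close> for \<open>r \<le> 1\<close>.  The last condition and an upper bound for \<open>\<Phi>\<close> pass to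
  a weak limit \<open>u\<close>, and \<open>E\<close> being negative there gives \<open>\<Upsilon> u < 0\<close>.  Since \<open>J\<close> becomes positive on the
  ray only beyond \<open>u\<close>, the minimum of \<open>\<Phi>\<close> on the first part of the ray is a left end point whose
  level is at most that of \<open>u\<close>, so it is a minimizer.  The same argument on neighbouring rays, where
  \<open>J (\<sigma> v) > 0\<close> persists for a fixed \<open>\<sigma> > 1\<close>, shows that it is a local minimizer of \<open>\<Phi>\<close>.  It is a
  ground state because \<open>\<Phi> > 0\<close> at the points of \<open>J = 0\<close> with \<open>\<Upsilon> \<ge> 0\<close>.

  Second critical point (\<open>falling_nehari_minimizer\<close>, \<open>falling_nehari_minimizer_critical\<close>).  Minimize
  \<open>\<Phi>\<close> over the set \<open>\<N>\<^sup>-\<close> (\<open>falling_nehari\<close>) of right end points: \<open>J u = 0\<close>, \<open>\<Gamma> u < 0\<close>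
  and \<open>J (r u) \<le> 0\<close> for \<open>r \<ge> 1\<close>.  On this set \<open>\<Gamma>\<close> is bounded away from \<open>0\<close>, so a weak limit \<open>v\<close> of a minimizing sequence \<open>x\<^sub>n\<close> still
  has \<open>\<Gamma> v < 0\<close>.  If \<open>J (r v) > 0\<close>, then \<open>J (r x\<^sub>n) > 0\<close> for large \<open>n\<close>, and so \<open>\<Phi> (s x\<^sub>n) \<le> \<Phi> (x\<^sub>n)\<close>
  for all \<open>s \<ge> r\<close>; taking for \<open>s v\<close> the right end point on the ray of \<open>v\<close>, weak lower
  semicontinuity makes \<open>s v\<close> a minimizer.  The minimizer is critical because the sign change
  of \<open>J\<close> across \<open>\<N>\<^sup>-\<close> is stable: if \<open>\<Phi>' (w) h < 0\<close> at a minimizer \<open>w\<close>, the ray through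
  \<open>w + e h\<close> meets \<open>\<N>\<^sup>-\<close> near \<open>w\<close>, at a lower level.

  Weak sequential compactness of bounded sets in reflexive spaces is derived from the Hahn-Banach
  theorem in its sublinear form, which is obtained from Zorn's lemma.
\<close>

section \<open>The Hahn-Banach theorem\<close>

definition sublinear :: "('v::real_vector \<Rightarrow> real) \<Rightarrow> bool" where
  "sublinear p \<longleftrightarrow> (\<forall>x y. p (x + y) \<le> p x + p y) \<and> (\<forall>t\<ge>0. \<forall>x. p (t *\<^sub>R x) \<le> t * p x)"

lemma sublinearI:
  assumes "\<And>x y. p (x + y) \<le> p x + p y" "\<And>t x. t \<ge> 0 \<Longrightarrow> p (t *\<^sub>R x) \<le> t * p x"
  shows "sublinear p"
  using assms by (simp add: sublinear_def)

lemma sublinear_add: "sublinear p \<Longrightarrow> p (x + y) \<le> p x + p y"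
  by (simp add: sublinear_def)

lemma sublinear_zero:
  assumes "sublinear p" shows "p 0 = 0"
proof -
  have "p 0 \<le> 0"
    using assms unfolding sublinear_def by (metis mult_zero_left order_refl scaleR_zero_left)
  moreover have "p 0 \<le> p 0 + p 0"
    using sublinear_add[OF assms, of 0 0] by simp
  ultimately show ?thesis by simp
qed

lemma sublinear_scaleR:
  assumes "sublinear p" "t \<ge> 0" shows "p (t *\<^sub>R x) = t * p x"
proof (cases "t = 0")
  case True
  then show ?thesis using sublinear_zero[OF assms(1)] by simp
next
  case False
  then have "t > 0" using assms by simp
  have "p (inverse t *\<^sub>R (t *\<^sub>R x)) \<le> inverse t * p (t *\<^sub>R x)"
    using assms \<open>t > 0\<close> unfolding sublinear_def by (meson inverse_nonnegative_iff_nonnegative)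
  then have "t * p x \<le> p (t *\<^sub>R x)"
    using \<open>t > 0\<close> by (simp add: field_simps)
  moreover have "p (t *\<^sub>R x) \<le> t * p x"
    using assms by (simp add: sublinear_def)
  ultimately show ?thesis by simp
qed

lemma sublinear_neg_le:
  assumes "sublinear p" shows "- p (- x) \<le> p x"
  using sublinear_add[OF assms, of x "- x"] sublinear_zero[OF assms] by simp

text \<open>Lowering a sublinear functional along the ray through \<open>v\<close>: the infimum is finite because
  \<open>t p(v) \<le> p(x + t v) + p(- x)\<close>, and \<open>t = 1\<close> makes the value at \<open>- v\<close> the smallest one possible.
  A sublinear functional that cannot be lowered is therefore odd, that is, linear.\<close>

lemma sublinear_lower_along_ray:
  assumes p: "sublinear p"
  obtains q where "sublinear q" "q \<le> p" "q (- v) \<le> - p v"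
proof -
  define q where "q x = (INF t\<in>{0..}. p (x + t *\<^sub>R v) - t * p v)" for x
  have bdd: "bdd_below ((\<lambda>t. p (x + t *\<^sub>R v) - t * p v) ` {0..})" for x
  proof (rule bdd_belowI2)
    fix t :: real assume "t \<in> {0..}"
    then show "- p (- x) \<le> p (x + t *\<^sub>R v) - t * p v"
      using sublinear_add[OF p, of "x + t *\<^sub>R v" "- x"] sublinear_scaleR[OF p, of t v] by simp
  qed
  have q_le: "q x \<le> p (x + t *\<^sub>R v) - t * p v" if "t \<ge> 0" for x t
    unfolding q_def using that by (intro cINF_lower[OF bdd]) auto
  have le_q: "b \<le> q x" if "\<And>t. t \<ge> 0 \<Longrightarrow> b \<le> p (x + t *\<^sub>R v) - t * p v" for b x
    unfolding q_def using that by (intro cINF_greatest) auto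
  have add: "q (x + y) \<le> q x + q y" for x y
  proof -
    have "q (x + y) - (p (x + s *\<^sub>R v) - s * p v) \<le> q y" if s: "s \<ge> 0" for s
    proof (rule le_q)
      fix t :: real assume t: "t \<ge> 0"
      have "q (x + y) \<le> p ((x + y) + (s + t) *\<^sub>R v) - (s + t) * p v"
        using s t by (intro q_le) simp
      moreover have "p ((x + y) + (s + t) *\<^sub>R v) \<le> p (x + s *\<^sub>R v) + p (y + t *\<^sub>R v)"
        using sublinear_add[OF p, of "x + s *\<^sub>R v" "y + t *\<^sub>R v"] by (simp add: algebra_simps)
      ultimately show "q (x + y) - (p (x + s *\<^sub>R v) - s * p v) \<le> p (y + t *\<^sub>R v) - t * p v"
        by (simp add: algebra_simps)
    qed
    then have "q (x + y) - q y \<le> q x"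
      by (intro le_q) (simp add: algebra_simps)
    then show ?thesis by simp
  qed
  have scale: "q (t *\<^sub>R x) \<le> t * q x" if t: "t \<ge> 0" for t x
  proof (cases "t = 0")
    case True
    then show ?thesis using q_le[of 0 0] sublinear_zero[OF p] by simp
  next
    case False
    with t have "t > 0" by simp
    have "inverse t * q (t *\<^sub>R x) \<le> q x"
    proof (rule le_q)
      fix s :: real assume "s \<ge> 0"
      then have "q (t *\<^sub>R x) \<le> p (t *\<^sub>R x + (t * s) *\<^sub>R v) - (t * s) * p v"
        using t by (intro q_le) simp
      also have "t *\<^sub>R x + (t * s) *\<^sub>R v = t *\<^sub>R (x + s *\<^sub>R v)"
        by (simp add: algebra_simps)
      also have "p \<dots> = t * p (x + s *\<^sub>R v)"
        by (rule sublinear_scaleR[OF p t])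
      finally show "inverse t * q (t *\<^sub>R x) \<le> p (x + s *\<^sub>R v) - s * p v"
        using \<open>t > 0\<close> by (simp add: field_simps)
    qed
    then show ?thesis using \<open>t > 0\<close> by (simp add: field_simps)
  qed
  show thesis
  proof
    show "sublinear q" using add scale by (rule sublinearI)
    show "q \<le> p" using q_le[of 0] by (simp add: le_fun_def)
    show "q (- v) \<le> - p v" using q_le[of 1 "- v"] sublinear_zero[OF p] by simp
  qed
qed

text \<open>Zorn's lemma is applied to sublinear functionals ordered pointwise.  The infimum of a chain is
  finite because \<open>- p (- x)\<close> is a common lower bound, and it is subadditive because of any two
  members of the chain the smaller one controls both summands.\<close>

lemma sublinear_chain_Inf:
  assumes ne: "K \<noteq> {}"
    and chain: "\<And>f g. f \<in> K \<Longrightarrow> g \<in> K \<Longrightarrow> f \<le> g \<or> g \<le> f"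
    and sub: "\<And>f. f \<in> K \<Longrightarrow> sublinear f \<and> f \<le> p"
  defines "q \<equiv> (\<lambda>x. INF f\<in>K. f x)"
  shows "sublinear q \<and> (\<forall>f\<in>K. q \<le> f)"
proof -
  have bdd: "bdd_below ((\<lambda>f. f x) ` K)" for x
  proof (rule bdd_belowI2)
    fix f assume "f \<in> K"
    then show "- p (- x) \<le> f x"
      using sub sublinear_neg_le[of f x] by (force simp: le_fun_def intro: order_trans[rotated])
  qed
  have q_le: "q x \<le> f x" if "f \<in> K" for f x
    unfolding q_def by (rule cINF_lower[OF bdd that])
  have le_q: "b \<le> q x" if "\<And>f. f \<in> K \<Longrightarrow> b \<le> f x" for b x
    unfolding q_def by (rule cINF_greatest[OF ne that])
  have add: "q (x + y) \<le> q x + q y" for x y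
  proof -
    have "q (x + y) \<le> f x + g y" if fg: "f \<in> K" "g \<in> K" for f g
    proof (cases "f \<le> g")
      case True
      then have "q (x + y) \<le> f x + f y" "f y \<le> g y"
        using q_le[OF fg(1), of "x + y"] sublinear_add[of f x y] sub[OF fg(1)]
        by (auto simp: le_fun_def)
      then show ?thesis by simp
    next
      case False
      then have "q (x + y) \<le> g x + g y" "g x \<le> f x"
        using chain[OF fg] q_le[OF fg(2), of "x + y"] sublinear_add[of g x y] sub[OF fg(2)]
        by (auto simp: le_fun_def)
      then show ?thesis by simp
    qed
    then have "q (x + y) - f x \<le> q y" if "f \<in> K" for f
      using that by (intro le_q) (metis add.commute diff_le_eq)
    then have "q (x + y) - q y \<le> q x"
      by (intro le_q) (simp add: algebra_simps)
    then show ?thesis by simp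
  qed
  have scale: "q (t *\<^sub>R x) \<le> t * q x" if t: "t \<ge> 0" for t x
  proof (cases "t = 0")
    case True
    obtain f where "f \<in> K" using ne by blast
    then show ?thesis using True q_le[of f 0] sublinear_zero[of f] sub by auto
  next
    case False
    with t have "t > 0" by simp
    have "inverse t * q (t *\<^sub>R x) \<le> q x"
    proof (rule le_q)
      fix f assume "f \<in> K"
      then show "inverse t * q (t *\<^sub>R x) \<le> f x"
        using q_le[of f "t *\<^sub>R x"] sublinear_scaleR[of f t x] sub t \<open>t > 0\<close>
        by (simp add: field_simps)
    qed
    then show ?thesis using \<open>t > 0\<close> by (simp add: field_simps)
  qed
  show ?thesis
    using sublinearI[OF add scale] q_le by (auto simp: le_fun_def)
qed

text \<open>A minimal sublinear functional below \<open>p\<close> cannot be lowered along any ray, so it is odd; and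
  an odd sublinear functional is linear.\<close>

theorem Hahn_Banach_sublinear:
  fixes p :: "'v::real_vector \<Rightarrow> real"
  assumes p: "sublinear p"
  obtains f where "linear f" "\<And>x. f x \<le> p x" "f v = p v"
proof -
  \<comment> \<open>Lowering first along the ray through \<open>v\<close> forces equality at \<open>v\<close> in the end.\<close>
  obtain p' where p': "sublinear p'" "p' \<le> p" "p' (- v) \<le> - p v"
    using sublinear_lower_along_ray[OF p] by blast
  define A where "A = {q. sublinear q \<and> q \<le> p'}"
  have "\<exists>m\<in>A. \<forall>a\<in>A. m \<ge> a \<longrightarrow> a = m"
  proof (rule predicate_Zorn)
    show "partial_order_on A (relation_of (\<ge>) A)"
      by (rule partial_order_on_relation_ofI) auto
    fix K assume K: "K \<in> Chains (relation_of (\<ge>) A)"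
    show "\<exists>u\<in>A. \<forall>a\<in>K. a \<ge> u"
    proof (cases "K = {}")
      case True
      then show ?thesis using p' by (auto simp: A_def)
    next
      case False
      have "K \<subseteq> A" using K by (rule Chains_relation_of)
      moreover have "f \<le> g \<or> g \<le> f" if "f \<in> K" "g \<in> K" for f g
        using K that by (auto simp: Chains_def relation_of_def)
      ultimately have *: "sublinear (\<lambda>x. INF f\<in>K. f x)" "\<forall>f\<in>K. (\<lambda>x. INF f\<in>K. f x) \<le> f"
        using sublinear_chain_Inf[of K p'] False by (auto simp: A_def)
      obtain f where "f \<in> K" using False by blast
      then have "(\<lambda>x. INF f\<in>K. f x) \<le> p'"
        using * \<open>K \<subseteq> A\<close> by (auto simp: A_def intro: order_trans)
      with * show ?thesis by (auto simp: A_def)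
    qed
  qed
  then obtain m where m: "sublinear m" "m \<le> p'"
    and minimal: "\<And>q. sublinear q \<Longrightarrow> q \<le> p' \<Longrightarrow> q \<le> m \<Longrightarrow> q = m"
    by (auto simp: A_def)
  have odd: "m (- x) = - m x" for x
  proof -
    obtain q where q: "sublinear q" "q \<le> m" "q (- x) \<le> - m x"
      using sublinear_lower_along_ray[OF m(1)] by blast
    then have "q = m" using minimal m(2) by (meson order_trans)
    with q show ?thesis using sublinear_neg_le[OF m(1), of x] by simp
  qed
  have "linear m"
  proof (rule linearI)
    fix x y
    show "m (x + y) = m x + m y"
      using sublinear_add[OF m(1), of x y] sublinear_add[OF m(1), of "- x" "- y"] odd[of x] odd[of y]
        odd[of "x + y"] by simp
  next
    fix t x
    show "m (t *\<^sub>R x) = t *\<^sub>R m x"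
    proof (cases "t \<ge> 0")
      case True
      then show ?thesis by (simp add: sublinear_scaleR[OF m(1)])
    next
      case False
      then have "m ((- t) *\<^sub>R x) = - t * m x" by (intro sublinear_scaleR[OF m(1)]) simp
      then show ?thesis using odd[of "t *\<^sub>R x"] by simp
    qed
  qed
  moreover have "m x \<le> p x" for x
    using m(2) p'(2) by (meson le_fun_def order_trans)
  moreover have "p v \<le> m v"
    using m(2) p'(3) odd[of v] le_funD[OF m(2), of "- v"] by simp
  ultimately show thesis using that by (meson order_antisym)
qed

corollary Hahn_Banach_blinfun:
  fixes p :: "'v::real_normed_vector \<Rightarrow> real"
  assumes p: "sublinear p" and bound: "\<And>x. p x \<le> K * norm x"
  obtains f :: "'v \<Rightarrow>\<^sub>L real" where "\<And>x. f x \<le> p x" "f v = p v"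
proof -
  obtain f where f: "linear f" "\<And>x. f x \<le> p x" "f v = p v"
    using Hahn_Banach_sublinear[OF p] by blast
  have "bounded_linear f"
  proof (rule bounded_linear_intro)
    show "f (x + y) = f x + f y" for x y using f(1) by (rule linear_add)
    show "f (t *\<^sub>R x) = t *\<^sub>R f x" for t x using f(1) by (rule linear_cmul)
    show "norm (f x) \<le> norm x * K" for x
      using f(2)[of x] bound[of x] f(2)[of "- x"] bound[of "- x"] linear_neg[OF f(1), of x]
      by (simp add: abs_le_iff mult.commute)
  qed
  then show thesis
    using that[of "Blinfun f"] f by (simp add: bounded_linear_Blinfun_apply)
qed

lemma norming_functional:
  obtains f :: "'v::real_normed_vector \<Rightarrow>\<^sub>L real" where "\<And>x. f x \<le> norm x" "f v = norm v"
proof (rule Hahn_Banach_blinfun)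
  show "sublinear (norm :: 'v \<Rightarrow> real)"
    by (rule sublinearI) (auto simp: norm_triangle_ineq)
  show "norm x \<le> 1 * norm x" for x :: 'v by simp
qed (rule that)

text \<open>The distance to a subspace is a sublinear functional bounded by the norm.\<close>

lemma separate_from_closed_subspace:
  fixes V :: "'v::real_normed_vector set"
  assumes V: "subspace V" "closed V" and v: "v \<notin> V"
  obtains f :: "'v \<Rightarrow>\<^sub>L real" where "\<And>x. x \<in> V \<Longrightarrow> f x \<le> 0" "f v > 0"
proof -
  have V0: "0 \<in> V" "V \<noteq> {}" using subspace_0[OF V(1)] by auto
  have approx: "\<exists>z\<in>V. norm (x - z) < infdist x V + e" if "e > 0" for x e
  proof -
    have "\<exists>z\<in>V. dist x z < infdist x V + e"
      using cInf_lessD[of "dist x ` V" "infdist x V + e"] that V0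
      by (auto simp: infdist_notempty)
    then show ?thesis by (simp add: dist_norm)
  qed
  have le: "infdist x V \<le> norm (x - z)" if "z \<in> V" for x z
    using infdist_le[OF that, of x] by (simp add: dist_norm)
  have "sublinear (\<lambda>x. infdist x V)"
  proof (rule sublinearI)
    fix x y
    show "infdist (x + y) V \<le> infdist x V + infdist y V"
    proof (rule field_le_epsilon)
      fix e :: real assume "e > 0"
      then obtain z w where zw: "z \<in> V" "norm (x - z) < infdist x V + e/2"
          "w \<in> V" "norm (y - w) < infdist y V + e/2"
        using approx[of "e/2" x] approx[of "e/2" y] by auto
      have "infdist (x + y) V \<le> norm ((x + y) - (z + w))"
        using zw V by (intro le) (simp add: subspace_add)
      also have "\<dots> \<le> norm (x - z) + norm (y - w)"
        using norm_triangle_ineq[of "x - z" "y - w"] by (simp add: algebra_simps)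
      finally show "infdist (x + y) V \<le> infdist x V + infdist y V + e"
        using zw by simp
    qed
  next
    fix t :: real and x assume t: "t \<ge> 0"
    show "infdist (t *\<^sub>R x) V \<le> t * infdist x V"
    proof (cases "t = 0")
      case True
      then show ?thesis using V0 by simp
    next
      case False
      with t have "t > 0" by simp
      show ?thesis
      proof (rule field_le_epsilon)
        fix e :: real assume "e > 0"
        then obtain z where z: "z \<in> V" "norm (x - z) < infdist x V + e/t"
          using approx[of "e/t" x] \<open>t > 0\<close> by auto
        have "infdist (t *\<^sub>R x) V \<le> norm (t *\<^sub>R x - t *\<^sub>R z)"
          using z V by (intro le) (simp add: subspace_scale)
        also have "\<dots> = t * norm (x - z)"
          using t by (simp flip: scaleR_diff_right)
        also have "\<dots> \<le> t * (infdist x V + e/t)"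
          using z t by (intro mult_left_mono) auto
        finally show "infdist (t *\<^sub>R x) V \<le> t * infdist x V + e"
          using \<open>t > 0\<close> by (simp add: distrib_left)
      qed
    qed
  qed
  moreover have "infdist x V \<le> 1 * norm x" for x
    using le[OF V0(1), of x] by simp
  ultimately obtain f :: "'v \<Rightarrow>\<^sub>L real" where f: "\<And>x. f x \<le> infdist x V" "f v = infdist v V"
    using Hahn_Banach_blinfun[of "\<lambda>x. infdist x V" 1 v] by blast
  show thesis
  proof (rule that)
    show "f x \<le> 0" if "x \<in> V" for x using f(1)[of x] that by simp
    show "f v > 0" using f(2) V v V0 by (simp add: infdist_pos_not_in_closed)
  qed
qed

section \<open>Weak sequential compactness\<close>

text \<open>The countable set consists of the rational linear combinations of the sequence.  Lists of
  coefficients encode it, and padding them by zeros makes sums coefficientwise.\<close>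

lemma countable_dense_span:
  fixes x :: "nat \<Rightarrow> 'v::real_normed_vector"
  obtains S where "countable S" "range x \<subseteq> S" "subspace (closure S)"
proof -
  define comb where "comb qs = (\<Sum>i<length qs. real_of_rat (qs ! i) *\<^sub>R x i)" for qs
  define S where "S = range comb"
  have pad: "comb (qs @ replicate k 0) = comb qs" for qs k
  proof -
    have "comb (qs @ replicate k 0) =
        (\<Sum>i<length qs. real_of_rat ((qs @ replicate k 0) ! i) *\<^sub>R x i)"
      unfolding comb_def by (rule sum.mono_neutral_right) (auto simp: nth_append)
    then show ?thesis by (simp add: comb_def nth_append)
  qed
  have add: "a + b \<in> S" if ab: "a \<in> S" "b \<in> S" for a b
  proof -
    obtain qs rs where qs: "a = comb qs" "b = comb rs" using ab unfolding S_def by blast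
    define n where "n = max (length qs) (length rs)"
    define qs' where "qs' = qs @ replicate (n - length qs) 0"
    define rs' where "rs' = rs @ replicate (n - length rs) 0"
    have len: "length qs' = n" "length rs' = n" by (auto simp: qs'_def rs'_def n_def)
    have "comb (map2 (+) qs' rs') = comb qs' + comb rs'"
      by (simp add: comb_def len of_rat_add scaleR_left_distrib sum.distrib)
    then have "a + b = comb (map2 (+) qs' rs')"
      by (simp add: qs qs'_def rs'_def pad)
    then show ?thesis by (simp add: S_def)
  qed
  have scale: "real_of_rat q *\<^sub>R a \<in> S" if a: "a \<in> S" for a q
  proof -
    obtain qs where qs: "a = comb qs" using a by (auto simp: S_def)
    have "comb (map ((*) q) qs) = real_of_rat q *\<^sub>R comb qs"
      by (simp add: comb_def of_rat_mult scaleR_sum_right)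
    then show ?thesis unfolding qs S_def by (metis rangeI)
  qed
  show thesis
  proof
    show "countable S" unfolding S_def by simp
    have "x n = comb (replicate n 0 @ [1])" for n
      by (simp add: comb_def nth_append)
    then show "range x \<subseteq> S" by (auto simp: S_def)
    show "subspace (closure S)"
      unfolding subspace_def
    proof (intro conjI ballI allI)
      have "comb [] = 0" by (simp add: comb_def)
      then have "0 \<in> S" by (metis S_def rangeI)
      then show "0 \<in> closure S" using closure_subset by blast
    next
      fix a b assume "a \<in> closure S" "b \<in> closure S"
      then obtain f g where "\<And>n. f n \<in> S" "f \<longlonglongrightarrow> a" "\<And>n. g n \<in> S" "g \<longlonglongrightarrow> b"
        unfolding closure_sequential by blast
      then have "\<And>n. f n + g n \<in> S" "(\<lambda>n. f n + g n) \<longlonglongrightarrow> a + b"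
        by (auto intro: add tendsto_add)
      then show "a + b \<in> closure S"
        unfolding closure_sequential by (intro exI[of _ "\<lambda>n. f n + g n"]) simp
    next
      fix a and t :: real assume "a \<in> closure S"
      then obtain f where f: "\<And>n. f n \<in> S" "f \<longlonglongrightarrow> a"
        unfolding closure_sequential by blast
      have "\<exists>q\<in>\<rat>. dist q t < e" if "e > 0" for e
        using Rats_dense_in_real[of t "t + e"] that by (force simp: dist_real_def)
      then have "t \<in> closure \<rat>" by (simp add: closure_approachable)
      then obtain q where q: "\<And>n. q n \<in> \<rat>" "q \<longlonglongrightarrow> t"
        unfolding closure_sequential by blast
      have "q n *\<^sub>R f n \<in> S" for n
        using q(1)[of n] scale[OF f(1)] by (auto simp: Rats_def)
      moreover have "(\<lambda>n. q n *\<^sub>R f n) \<longlonglongrightarrow> t *\<^sub>R a"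
        using q(2) f(2) by (rule tendsto_scaleR)
      ultimately show "t *\<^sub>R a \<in> closure S"
        unfolding closure_sequential by (intro exI[of _ "\<lambda>n. q n *\<^sub>R f n"]) simp
    qed
  qed
qed

text \<open>The condition says that \<open>f u\<close> is at most the limit superior of \<open>f (x n)\<close>; applied to \<open>- f\<close> it
  also says that \<open>f u\<close> is at least the limit inferior.\<close>

definition generalized_weak_limit :: "(nat \<Rightarrow> 'a::real_normed_vector) \<Rightarrow> 'a \<Rightarrow> bool" where
  "generalized_weak_limit x u \<longleftrightarrow>
     (\<forall>(f :: 'a \<Rightarrow>\<^sub>L real) b. (\<forall>\<^sub>F n in sequentially. f (x n) \<le> b) \<longrightarrow> f u \<le> b)"

text \<open>The limit superior of \<open>f (x n)\<close> is a sublinear functional of \<open>f\<close>.  A linear functional below it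
  is bounded on the dual space, hence evaluation at a point \<open>u\<close> by reflexivity, and it may be chosen
  to attain the limit superior at one prescribed functional \<open>g\<close>.\<close>

lemma generalized_weak_limit_exists:
  fixes x :: "nat \<Rightarrow> 'a::real_normed_vector" and g :: "'a \<Rightarrow>\<^sub>L real"
  assumes refl: "reflexive_space TYPE('a)" and bound: "\<And>n. norm (x n) \<le> M"
  obtains u where "generalized_weak_limit x u"
    "\<And>b. g u < b \<Longrightarrow> \<forall>\<^sub>F n in sequentially. g (x n) \<le> b"
proof -
  define B where "B f = {b. \<forall>\<^sub>F n in sequentially. blinfun_apply f (x n) \<le> b}"
    for f :: "'a \<Rightarrow>\<^sub>L real"
  define p where "p f = Inf (B f)" for f
  have abs_bound: "\<bar>blinfun_apply f (x n)\<bar> \<le> M * norm f" for f n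
    using norm_blinfun[of f "x n"] mult_left_mono[OF bound[of n] norm_ge_zero[of f]]
    by (simp add: mult.commute)
  have mem: "M * norm f \<in> B f" for f
    unfolding B_def using abs_bound by (auto simp: abs_le_iff)
  have lower: "- (M * norm f) \<le> b" if "b \<in> B f" for f b
  proof -
    have "\<forall>\<^sub>F n in sequentially. blinfun_apply f (x n) \<le> b" using that by (simp add: B_def)
    then obtain n where "blinfun_apply f (x n) \<le> b"
      unfolding eventually_sequentially by blast
    then show ?thesis using abs_bound[of f n] by (simp add: abs_le_iff)
  qed
  have bdd: "bdd_below (B f)" for f using lower by (rule bdd_belowI)
  have p_le: "p f \<le> b" if "b \<in> B f" for f b
    unfolding p_def by (rule cInf_lower[OF that bdd])
  have le_p: "b \<le> p f" if "\<And>a. a \<in> B f \<Longrightarrow> b \<le> a" for f b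
    unfolding p_def using mem by (intro cInf_greatest that) auto
  have "sublinear p"
  proof (rule sublinearI)
    fix f g
    have "p (f + g) \<le> a + b" if "a \<in> B f" "b \<in> B g" for a b
    proof (rule p_le)
      have "\<forall>\<^sub>F n in sequentially. blinfun_apply f (x n) \<le> a"
        "\<forall>\<^sub>F n in sequentially. blinfun_apply g (x n) \<le> b"
        using that by (auto simp: B_def)
      then have "\<forall>\<^sub>F n in sequentially. blinfun_apply (f + g) (x n) \<le> a + b"
        by eventually_elim (simp add: blinfun.add_left)
      then show "a + b \<in> B (f + g)" by (simp add: B_def)
    qed
    then have "p (f + g) - a \<le> p g" if "a \<in> B f" for a
      using that by (intro le_p) (metis add.commute diff_le_eq)
    then have "p (f + g) - p g \<le> p f" by (intro le_p) (simp add: algebra_simps)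
    then show "p (f + g) \<le> p f + p g" by simp
  next
    fix t :: real and f assume t: "t \<ge> 0"
    show "p (t *\<^sub>R f) \<le> t * p f"
    proof (cases "t = 0")
      case True
      then show ?thesis using p_le[OF mem[of 0]] by simp
    next
      case False
      with t have "t > 0" by simp
      have "inverse t * p (t *\<^sub>R f) \<le> p f"
      proof (rule le_p)
        fix a assume "a \<in> B f"
        then have "\<forall>\<^sub>F n in sequentially. blinfun_apply f (x n) \<le> a" by (simp add: B_def)
        then have "\<forall>\<^sub>F n in sequentially. blinfun_apply (t *\<^sub>R f) (x n) \<le> t * a"
          by eventually_elim (use t in \<open>auto simp: blinfun.scaleR_left intro: mult_left_mono\<close>)
        then have "p (t *\<^sub>R f) \<le> t * a" by (intro p_le) (simp add: B_def)
        then show "inverse t * p (t *\<^sub>R f) \<le> a" using \<open>t > 0\<close> by (simp add: field_simps)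
      qed
      then show ?thesis using \<open>t > 0\<close> by (simp add: field_simps)
    qed
  qed
  moreover have "p f \<le> M * norm f" for f using mem by (rule p_le)
  ultimately obtain F :: "('a \<Rightarrow>\<^sub>L real) \<Rightarrow>\<^sub>L real"
    where F: "\<And>f. blinfun_apply F f \<le> p f" "blinfun_apply F g = p g"
    using Hahn_Banach_blinfun[of p M g] by blast
  obtain u where u: "\<And>f. blinfun_apply F f = blinfun_apply f u"
    using refl unfolding reflexive_space_def by blast
  show thesis
  proof
    show "generalized_weak_limit x u"
      unfolding generalized_weak_limit_def
      using F(1) u p_le by (metis (mono_tags, lifting) B_def mem_Collect_eq order_trans)
    fix b assume "g u < b"
    then have "Inf (B g) < b" using F(2) u by (simp add: p_def)
    then obtain a where "a \<in> B g" "a < b" using mem by (metis cInf_lessD empty_iff)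
    then show "\<forall>\<^sub>F n in sequentially. g (x n) \<le> b"
      by (auto simp: B_def elim: eventually_mono)
  qed
qed

lemma generalized_weak_limit_eq_lim:
  fixes f :: "'a::real_normed_vector \<Rightarrow>\<^sub>L real"
  assumes u: "generalized_weak_limit x u" and lim: "(\<lambda>n. blinfun_apply f (x n)) \<longlonglongrightarrow> l"
  shows "blinfun_apply f u = l"
proof (rule order_antisym)
  have *: "blinfun_apply g u \<le> k" if "(\<lambda>n. blinfun_apply g (x n)) \<longlonglongrightarrow> k"
    for g :: "'a \<Rightarrow>\<^sub>L real" and k
  proof (rule field_le_epsilon)
    fix e :: real assume "e > 0"
    then have "\<forall>\<^sub>F n in sequentially. blinfun_apply g (x n) < k + e"
      using that by (intro order_tendstoD) auto
    then have "\<forall>\<^sub>F n in sequentially. blinfun_apply g (x n) \<le> k + e"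
      by (rule eventually_mono) simp
    then show "blinfun_apply g u \<le> k + e" using u by (simp add: generalized_weak_limit_def)
  qed
  show "blinfun_apply f u \<le> l" using lim by (rule *)
  have "(\<lambda>n. blinfun_apply (- f) (x n)) \<longlonglongrightarrow> - l"
    using tendsto_minus[OF lim] by (simp add: blinfun.minus_left)
  then show "l \<le> blinfun_apply f u" using *[of "- f" "- l"] by (simp add: blinfun.minus_left)
qed

text \<open>For every \<open>s\<close> in a countable dense subset of the span of the sequence let \<open>D s\<close> be a functional
  norming \<open>s\<close>.  A diagonal argument gives a subsequence along which all \<open>D s\<close> converge.  Generalized
  weak limits of this subsequence lie in the closed span and agree under all \<open>D s\<close>, and these
  functionals separate the points of the closed span, so there is only one such limit.  As the limit
  superior of every functional is attained by some generalized limit, the subsequence converges weakly.\<close>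

theorem reflexive_bounded_imp_weakly_convergent_subseq:
  fixes x :: "nat \<Rightarrow> 'a::real_normed_vector"
  assumes refl: "reflexive_space TYPE('a)" and bound: "\<And>n. norm (x n) \<le> M"
  obtains r u where "strict_mono r" "weakly_converges (x \<circ> r) u"
proof -
  obtain S where S: "countable S" "range x \<subseteq> S" "subspace (closure S)"
    using countable_dense_span by blast
  have "\<forall>s. \<exists>f :: 'a \<Rightarrow>\<^sub>L real. (\<forall>v. f v \<le> norm v) \<and> f s = norm s"
    using norming_functional by metis
  then obtain D :: "'a \<Rightarrow> 'a \<Rightarrow>\<^sub>L real"
    where D: "\<And>s v. D s v \<le> norm v" "\<And>s. D s s = norm s"
    by metis
  have "norm (D s (x n)) \<le> M" for s n
    using D(1)[of s "x n"] D(1)[of s "- x n"] bound[of n] by (simp add: blinfun.minus_right)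
  then obtain r :: "nat \<Rightarrow> nat" where r: "strict_mono r"
    and conv: "\<And>s. s \<in> S \<Longrightarrow> \<exists>l. (\<lambda>n. D s (x (r n))) \<longlonglongrightarrow> l"
    using function_convergent_subsequence[OF S(1), of "\<lambda>n s. blinfun_apply (D s) (x n)" M] by metis
  define y where "y = x \<circ> r"
  have y_bound: "\<And>n. norm (y n) \<le> M" using bound by (simp add: y_def)
  have in_closure: "u \<in> closure S" if u: "generalized_weak_limit y u" for u
  proof (rule ccontr)
    assume "u \<notin> closure S"
    then obtain f :: "'a \<Rightarrow>\<^sub>L real" where f: "\<And>v. v \<in> closure S \<Longrightarrow> f v \<le> 0" "f u > 0"
      using separate_from_closed_subspace[OF S(3) closed_closure] by blast
    have "f (y n) \<le> 0" for n
      using f(1) S(2) closure_subset[of S] by (auto simp: y_def)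
    then have "f u \<le> 0" using u by (simp add: generalized_weak_limit_def)
    with f(2) show False by simp
  qed
  have unique: "u = v" if uv: "generalized_weak_limit y u" "generalized_weak_limit y v" for u v
  proof (rule ccontr)
    assume "u \<noteq> v"
    define d where "d = u - v"
    have "d \<noteq> 0" using \<open>u \<noteq> v\<close> by (simp add: d_def)
    have "d \<in> closure S" unfolding d_def
      using in_closure uv S(3) by (simp add: subspace_diff)
    then obtain s where s: "s \<in> S" "dist s d < norm d / 2"
      using \<open>d \<noteq> 0\<close> by (metis closure_approachable half_gt_zero zero_less_norm_iff)
    obtain l where "(\<lambda>n. D s (y n)) \<longlonglongrightarrow> l" using conv[OF s(1)] by (auto simp: y_def)
    then have "D s u = D s v" using uv by (simp add: generalized_weak_limit_eq_lim)
    then have "norm s = D s (s - d)"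
      by (simp add: d_def blinfun.diff_right D(2))
    also have "\<dots> \<le> norm (s - d)" by (rule D(1))
    finally have "norm d \<le> 2 * norm (s - d)"
      using norm_triangle_ineq2[of d s] by (simp add: norm_minus_commute)
    then show False using s(2) by (simp add: dist_norm)
  qed
  obtain u where u: "generalized_weak_limit y u"
    by (rule generalized_weak_limit_exists[where x = y and M = M and g = 0, OF refl y_bound])
  \<comment> \<open>A limit attaining the limit superior of \<open>g\<close> along the sequence is again \<open>u\<close>.\<close>
  have upper: "\<forall>\<^sub>F n in sequentially. g (y n) \<le> b" if "g u < b" for g :: "'a \<Rightarrow>\<^sub>L real" and b
  proof -
    obtain v where v: "generalized_weak_limit y v"
      "\<And>b. g v < b \<Longrightarrow> \<forall>\<^sub>F n in sequentially. g (y n) \<le> b"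
      by (rule generalized_weak_limit_exists[where x = y and M = M and g = g, OF refl y_bound]) blast
    show ?thesis using v(2)[of b] that unique[OF u v(1)] by simp
  qed
  have "weakly_converges y u"
    unfolding weakly_converges_def
  proof (intro allI order_tendstoI)
    fix f :: "'a \<Rightarrow>\<^sub>L real" and a
    assume "f u < a"
    then obtain b where "f u < b" "b < a" using dense by blast
    then show "\<forall>\<^sub>F n in sequentially. f (y n) < a"
      using upper[of f b] by (auto elim: eventually_mono)
  next
    fix f :: "'a \<Rightarrow>\<^sub>L real" and a
    assume "a < f u"
    then obtain b where "a < b" "b < f u" using dense by blast
    then show "\<forall>\<^sub>F n in sequentially. a < f (y n)"
      using upper[of "- f" "- b"] by (auto simp: blinfun.minus_left elim: eventually_mono)
  qed
  then show thesis using that r y_def by blast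
qed

section \<open>Weak lower semicontinuity\<close>

lemma weakly_lsc_iff:
  "weakly_lsc H \<longleftrightarrow>
     (\<forall>x u. weakly_converges x u \<longrightarrow> (\<forall>e<H u. \<forall>\<^sub>F n in sequentially. e < H (x n)))"
proof -
  have "ereal a \<le> liminf (\<lambda>n. ereal (b n)) \<longleftrightarrow> (\<forall>e<a. \<forall>\<^sub>F n in sequentially. e < b n)"
    for a :: real and b
  proof
    assume *: "ereal a \<le> liminf (\<lambda>n. ereal (b n))"
    show "\<forall>e<a. \<forall>\<^sub>F n in sequentially. e < b n"
    proof (intro allI impI)
      fix e assume "e < a"
      then have "ereal e < ereal a" by simp
      then have "\<forall>\<^sub>F n in sequentially. ereal e < ereal (b n)"
        using * unfolding le_Liminf_iff by blast
      then show "\<forall>\<^sub>F n in sequentially. e < b n" by simp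
    qed
  next
    assume *: "\<forall>e<a. \<forall>\<^sub>F n in sequentially. e < b n"
    show "ereal a \<le> liminf (\<lambda>n. ereal (b n))"
      unfolding le_Liminf_iff
    proof (intro allI impI)
      fix y assume "y < ereal a"
      then show "\<forall>\<^sub>F n in sequentially. y < ereal (b n)"
        using * by (cases y) auto
    qed
  qed
  then show ?thesis by (simp add: weakly_lsc_def)
qed

lemma weakly_lsc_add:
  assumes "weakly_lsc F" "weakly_lsc G"
  shows "weakly_lsc (\<lambda>u. F u + G u)"
  unfolding weakly_lsc_iff
proof (intro allI impI)
  fix x u e assume xu: "weakly_converges x u" and e: "e < F u + G u"
  define d where "d = (F u + G u - e) / 2"
  have "d > 0" using e by (simp add: d_def)
  then have "\<forall>\<^sub>F n in sequentially. F u - d < F (x n)" "\<forall>\<^sub>F n in sequentially. G u - d < G (x n)"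
    using assms xu unfolding weakly_lsc_iff by simp_all
  then show "\<forall>\<^sub>F n in sequentially. e < F (x n) + G (x n)"
    by eventually_elim (simp add: d_def field_simps)
qed

lemma weakly_lsc_cmult:
  assumes "weakly_lsc F" "c > 0"
  shows "weakly_lsc (\<lambda>u. c * F u)"
  unfolding weakly_lsc_iff
proof (intro allI impI)
  fix x u e assume xu: "weakly_converges x u" and e: "e < c * F u"
  then have "e / c < F u" using assms(2) by (simp add: field_simps)
  then have "\<forall>\<^sub>F n in sequentially. e / c < F (x n)"
    using assms xu unfolding weakly_lsc_iff by blast
  then show "\<forall>\<^sub>F n in sequentially. e < c * F (x n)"
    by eventually_elim (use assms(2) in \<open>simp add: field_simps\<close>)
qed

lemma weakly_lsc_limit_le:
  assumes lsc: "weakly_lsc H" and x: "weakly_converges x u"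
    and le: "\<forall>\<^sub>F n in sequentially. H (x n) \<le> b n" and lim: "b \<longlonglongrightarrow> l"
  shows "H u \<le> l"
proof (rule ccontr)
  assume "\<not> H u \<le> l"
  then obtain e where "l < e" "e < H u" using dense[of l "H u"] by auto
  then have "\<forall>\<^sub>F n in sequentially. e < H (x n)" "\<forall>\<^sub>F n in sequentially. b n < e"
    using lsc x lim by (auto simp: weakly_lsc_iff intro: order_tendstoD)
  with le have "\<forall>\<^sub>F n in sequentially. False"
    by eventually_elim simp
  then show False by simp
qed

lemma weakly_converges_scaleR:
  assumes "weakly_converges x u"
  shows "weakly_converges (\<lambda>n. t *\<^sub>R x n) (t *\<^sub>R u)"
  using assms unfolding weakly_converges_def
  by (simp add: blinfun.scaleR_right tendsto_mult_left)

section \<open>Sums of two powers\<close>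

text \<open>The derivative of \<open>k\<close> is a positive factor times \<open>m t = a B + b D t powr (b - a)\<close>, which either
  stays positive (\<open>D \<ge> 0\<close>) or changes sign once, from plus to minus.  Hence \<open>k\<close> increases up to \<open>y\<close>
  or decreases from \<open>y\<close> on.\<close>

lemma powr_sum_quasi_concave:
  fixes a b B D :: real
  assumes ab: "0 < a" "a < b" and B: "B > 0" and xyz: "0 < x" "x < y" "y < z"
  defines "k \<equiv> \<lambda>t. B * t powr a + D * t powr b"
  shows "min (k x) (k z) < k y"
proof -
  define m where "m t = a * B + b * D * t powr (b - a)" for t
  have deriv: "(k has_real_derivative t powr (a - 1) * m t) (at t)" if "t > 0" for t
  proof -
    have "t powr (b - 1) = t powr (a - 1) * t powr (b - a)"
      by (simp flip: powr_add)
    then show ?thesis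
      unfolding k_def m_def using that
      by (auto intro!: derivative_eq_intros simp: algebra_simps)
  qed
  have cont: "continuous_on {s..t} k" if "s > 0" for s t
    using deriv that by (intro DERIV_continuous_on[of _ k "\<lambda>t. t powr (a - 1) * m t"])
      (auto intro: has_field_derivative_at_within)
  have mono: "s powr (b - a) < t powr (b - a)" if "0 < s" "s < t" for s t :: real
    using that ab by (intro powr_less_mono2) auto
  show ?thesis
  proof (cases "m y \<ge> 0")
    case True
    have "k x < k y"
    proof (rule DERIV_pos_imp_increasing_open[OF xyz(2) _ cont[OF xyz(1)]])
      fix t assume t: "x < t" "t < y"
      have "m t > 0"
      proof (cases "D \<ge> 0")
        case True
        then show ?thesis using ab B by (auto simp: m_def intro!: add_pos_nonneg)
      next
        case False
        then have "b * D * y powr (b - a) < b * D * t powr (b - a)"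
          using mono[of t y] t xyz ab by (intro mult_strict_left_mono_neg) (auto simp: mult_pos_neg)
        then show ?thesis using \<open>m y \<ge> 0\<close> by (simp add: m_def)
      qed
      then show "\<exists>c. (k has_real_derivative c) (at t) \<and> c > 0"
        using deriv[of t] t xyz by (intro exI[of _ "t powr (a - 1) * m t"]) auto
    qed
    then show ?thesis by simp
  next
    case False
    have "D < 0"
    proof (rule ccontr)
      assume "\<not> D < 0"
      then have "m y \<ge> 0" using ab B by (auto simp: m_def intro!: add_nonneg_nonneg)
      with False show False by simp
    qed
    have "k y > k z"
    proof (rule DERIV_neg_imp_decreasing_open[OF xyz(3) _ cont])
      fix t assume t: "y < t" "t < z"
      have "b * D * t powr (b - a) < b * D * y powr (b - a)"
        using mono[of y t] t xyz ab \<open>D < 0\<close>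
        by (intro mult_strict_left_mono_neg) (auto simp: mult_pos_neg)
      then have "m t < 0" using False by (simp add: m_def)
      then show "\<exists>c. (k has_real_derivative c) (at t) \<and> c < 0"
        using deriv[of t] t xyz
        by (intro exI[of _ "t powr (a - 1) * m t"]) (auto simp: mult_pos_neg)
    qed (use xyz in auto)
    then show ?thesis by simp
  qed
qed

lemma powr_difference_coercive:
  fixes a b p q M :: real
  assumes "0 < q" "q < p" "0 < a" "0 \<le> b"
  obtains R where "R \<ge> 0" "\<And>x. x \<ge> 0 \<Longrightarrow> a * x powr p - b * x powr q \<le> M \<Longrightarrow> x \<le> R"
proof
  define K where "K = (b + \<bar>M\<bar>) / a"
  define R where "R = max 1 (K powr (1 / (p - q)))"
  show "R \<ge> 0" by (simp add: R_def)
  fix x :: real assume x: "x \<ge> 0" and le: "a * x powr p - b * x powr q \<le> M"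
  show "x \<le> R"
  proof (rule ccontr)
    assume "\<not> x \<le> R"
    then have gt: "x > 1" "x > K powr (1 / (p - q))" by (auto simp: R_def)
    have "K \<ge> 0" using assms by (simp add: K_def)
    have "(K powr (1 / (p - q))) powr (p - q) < x powr (p - q)"
      using gt assms by (intro powr_less_mono2) auto
    then have "K < x powr (p - q)"
      using assms \<open>K \<ge> 0\<close> by (simp add: powr_powr)
    then have *: "\<bar>M\<bar> < a * x powr (p - q) - b"
      using assms by (simp add: K_def field_simps)
    have "\<bar>M\<bar> * 1 < (a * x powr (p - q) - b) * x powr q"
      using * gt assms by (intro mult_less_le_imp_less) (auto simp: ge_one_powr_ge_zero)
    also have "\<dots> = a * x powr p - b * x powr q"
      by (simp add: left_diff_distrib mult.assoc flip: powr_add)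
    finally show False using le by simp
  qed
qed

section \<open>Fibering maps\<close>

locale homogeneous_sum =
  fixes P \<Upsilon> \<Gamma> :: "'a::real_normed_vector \<Rightarrow> real" and \<kappa> \<upsilon> \<gamma> C :: real
  assumes exponents: "0 < \<upsilon>" "\<upsilon> < \<kappa>" "\<kappa> < \<gamma>"
    and C1: "C1_functional P" "C1_functional \<Upsilon>" "C1_functional \<Gamma>"
    and homogeneity: "homogeneous \<kappa> P" "homogeneous \<upsilon> \<Upsilon>" "homogeneous \<gamma> \<Gamma>"
    and C_pos: "C > 0"
    and P_bound: "\<And>u. P u \<ge> inverse C * norm u powr \<kappa>"
    and \<Upsilon>_bound: "\<And>u. \<bar>\<Upsilon> u\<bar> \<le> C * norm u powr \<upsilon>"
    and \<Gamma>_bound: "\<And>u. \<bar>\<Gamma> u\<bar> \<le> C * norm u powr \<gamma>"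
begin

definition \<Phi> :: "'a \<Rightarrow> real" where "\<Phi> u = 1/\<kappa> * P u + 1/\<upsilon> * \<Upsilon> u + 1/\<gamma> * \<Gamma> u"

definition J :: "'a \<Rightarrow> real" where "J u = P u + \<Upsilon> u + \<Gamma> u"

lemma radial_derivative_\<Phi>: "radial_derivative \<Phi> u = J u"
proof -
  have "\<Phi> = (\<lambda>u. 1/\<kappa> * P u + 1/\<upsilon> * \<Upsilon> u + 1/\<gamma> * \<Gamma> u)" by (simp add: \<Phi>_def fun_eq_iff)
  then show ?thesis
    using radial_derivative_sum[of \<kappa> \<upsilon> \<gamma> P \<Upsilon> \<Gamma> u] exponents C1 homogeneity by (simp add: J_def)
qed

lemma scale:
  assumes "t > 0"
  shows "P (t *\<^sub>R u) = t powr \<kappa> * P u" "\<Upsilon> (t *\<^sub>R u) = t powr \<upsilon> * \<Upsilon> u"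
    "\<Gamma> (t *\<^sub>R u) = t powr \<gamma> * \<Gamma> u"
  using homogeneity assms by (auto simp: homogeneous_def)

lemma P_pos: "u \<noteq> 0 \<Longrightarrow> P u > 0"
  using P_bound[of u] C_pos by (intro less_le_trans[OF _ P_bound]) simp

lemma zero_values: "\<Upsilon> 0 = 0" "\<Gamma> 0 = 0" "P 0 = 0"
proof -
  show "\<Upsilon> 0 = 0" "\<Gamma> 0 = 0" using \<Upsilon>_bound[of 0] \<Gamma>_bound[of 0] by auto
  have "2 powr \<kappa> \<noteq> (1::real)" using exponents by simp
  then show "P 0 = 0" using scale(1)[of 2 0] by simp
qed

lemma P_nonneg: "P u \<ge> 0"
  using P_pos[of u] zero_values by (cases "u = 0") auto

lemma \<Phi>_zero: "\<Phi> 0 = 0"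
  by (simp add: \<Phi>_def zero_values)

lemma \<Phi>_C1:
  obtains \<Phi>' :: "'a \<Rightarrow> 'a \<Rightarrow>\<^sub>L real"
  where "\<And>u. (\<Phi> has_derivative blinfun_apply (\<Phi>' u)) (at u)" "continuous_on UNIV \<Phi>'"
proof -
  obtain P' \<Upsilon>' \<Gamma>' :: "'a \<Rightarrow> 'a \<Rightarrow>\<^sub>L real" where
    d: "\<And>u. (P has_derivative P' u) (at u)" "\<And>u. (\<Upsilon> has_derivative \<Upsilon>' u) (at u)"
      "\<And>u. (\<Gamma> has_derivative \<Gamma>' u) (at u)"
    and c: "continuous_on UNIV P'" "continuous_on UNIV \<Upsilon>'" "continuous_on UNIV \<Gamma>'"
    using C1 unfolding C1_functional_def by blast
  show thesis
  proof
    show "(\<Phi> has_derivative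
        blinfun_apply ((1/\<kappa>) *\<^sub>R P' u + (1/\<upsilon>) *\<^sub>R \<Upsilon>' u + (1/\<gamma>) *\<^sub>R \<Gamma>' u)) (at u)" for u
    proof -
      have "((\<lambda>u. 1/\<kappa> * P u + 1/\<upsilon> * \<Upsilon> u + 1/\<gamma> * \<Gamma> u) has_derivative
          (\<lambda>h. 1/\<kappa> * P' u h + 1/\<upsilon> * \<Upsilon>' u h + 1/\<gamma> * \<Gamma>' u h)) (at u)"
        by (intro has_derivative_add has_derivative_mult_right d)
      then show ?thesis
        by (simp add: \<Phi>_def[abs_def] blinfun.add_left[abs_def] blinfun.scaleR_left[abs_def])
    qed
    show "continuous_on UNIV (\<lambda>u. (1/\<kappa>) *\<^sub>R P' u + (1/\<upsilon>) *\<^sub>R \<Upsilon>' u + (1/\<gamma>) *\<^sub>R \<Gamma>' u)"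
      by (intro continuous_intros c)
  qed
qed

lemma continuous_P\<Upsilon>\<Gamma>:
  "continuous_on UNIV P" "continuous_on UNIV \<Upsilon>" "continuous_on UNIV \<Gamma>"
  using C1 unfolding C1_functional_def
  by (metis has_derivative_continuous continuous_at_imp_continuous_on)+

lemma continuous_\<Phi>: "continuous_on S \<Phi>"
  unfolding \<Phi>_def
  by (intro continuous_intros; rule continuous_on_subset[OF _ subset_UNIV]; rule continuous_P\<Upsilon>\<Gamma>)

lemma continuous_J: "continuous_on S J"
  unfolding J_def
  by (intro continuous_intros; rule continuous_on_subset[OF _ subset_UNIV]; rule continuous_P\<Upsilon>\<Gamma>)

lemma isCont_functionals: "isCont \<Upsilon> u" "isCont \<Gamma> u" "isCont J u"
  using continuous_P\<Upsilon>\<Gamma> continuous_J[of UNIV] by (auto simp: continuous_on_eq_continuous_at)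

lemma continuous_ray:
  "continuous_on S (\<lambda>t::real. \<Phi> (t *\<^sub>R u))" "continuous_on S (\<lambda>t::real. J (t *\<^sub>R u))"
  by (rule continuous_on_compose2[OF continuous_\<Phi>[of UNIV]] continuous_on_compose2[OF continuous_J[of UNIV]],
      intro continuous_intros, simp)+

lemma J_ray:
  assumes "t > 0"
  shows "J (t *\<^sub>R u) = t powr \<upsilon> * (\<Upsilon> u + (P u * t powr (\<kappa> - \<upsilon>) + \<Gamma> u * t powr (\<gamma> - \<upsilon>)))"
  unfolding J_def scale[OF assms] by (simp add: algebra_simps flip: powr_add)

lemma DERIV_\<Phi>_ray:
  assumes "t > 0"
  shows "((\<lambda>r. \<Phi> (r *\<^sub>R u)) has_real_derivative J (t *\<^sub>R u) / t) (at t)"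
proof (rule DERIV_cong)
  show "((\<lambda>r. \<Phi> (r *\<^sub>R u)) has_real_derivative
      t powr (\<kappa> - 1) * P u + t powr (\<upsilon> - 1) * \<Upsilon> u + t powr (\<gamma> - 1) * \<Gamma> u) (at t)"
  proof (rule has_field_derivative_transform_within_open[where S = "{0<..}"])
    show "((\<lambda>r. 1/\<kappa> * (r powr \<kappa> * P u) + 1/\<upsilon> * (r powr \<upsilon> * \<Upsilon> u) + 1/\<gamma> * (r powr \<gamma> * \<Gamma> u))
        has_real_derivative
        t powr (\<kappa> - 1) * P u + t powr (\<upsilon> - 1) * \<Upsilon> u + t powr (\<gamma> - 1) * \<Gamma> u) (at t)"
      using assms exponents by (auto intro!: derivative_eq_intros)
  qed (use assms in \<open>auto simp: \<Phi>_def scale\<close>)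
  show "t powr (\<kappa> - 1) * P u + t powr (\<upsilon> - 1) * \<Upsilon> u + t powr (\<gamma> - 1) * \<Gamma> u = J (t *\<^sub>R u) / t"
    using assms by (simp add: J_def scale powr_diff field_simps)
qed

lemma \<Phi>_ray_strict_increasing:
  assumes "0 \<le> x" "x < z" "\<And>t. x < t \<Longrightarrow> t < z \<Longrightarrow> J (t *\<^sub>R u) > 0"
  shows "\<Phi> (x *\<^sub>R u) < \<Phi> (z *\<^sub>R u)"
proof (rule DERIV_pos_imp_increasing_open[OF assms(2) _ continuous_ray(1)])
  fix t assume "x < t" "t < z"
  then show "\<exists>y. ((\<lambda>r. \<Phi> (r *\<^sub>R u)) has_real_derivative y) (at t) \<and> 0 < y"
    using DERIV_\<Phi>_ray[of t u] assms by (intro exI[of _ "J (t *\<^sub>R u) / t"]) simp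
qed

lemma \<Phi>_ray_decreasing:
  assumes "0 \<le> x" "x \<le> z" "\<And>t. x < t \<Longrightarrow> t < z \<Longrightarrow> J (t *\<^sub>R u) \<le> 0"
  shows "\<Phi> (z *\<^sub>R u) \<le> \<Phi> (x *\<^sub>R u)"
proof (rule DERIV_nonpos_imp_decreasing_open[OF assms(2) _ continuous_ray(1)])
  fix t assume "x < t" "t < z"
  then show "\<exists>y. ((\<lambda>r. \<Phi> (r *\<^sub>R u)) has_real_derivative y) (at t) \<and> y \<le> 0"
    using DERIV_\<Phi>_ray[of t u] assms
    by (intro exI[of _ "J (t *\<^sub>R u) / t"]) (simp add: divide_le_0_iff)
qed

text \<open>Up to a positive factor and the constant \<open>\<Upsilon> u\<close>, \<open>J\<close> is on each ray a sum of two powers as in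
  \<open>powr_sum_quasi_concave\<close>.  Consequently \<open>J\<close> is positive on a single interval of the ray.\<close>

lemma J_ray_pos_between:
  assumes u: "u \<noteq> 0" and xyz: "0 < x" "x < y" "y < z"
    and J: "J (x *\<^sub>R u) \<ge> 0" "J (z *\<^sub>R u) \<ge> 0"
  shows "J (y *\<^sub>R u) > 0"
proof -
  define k where "k t = P u * t powr (\<kappa> - \<upsilon>) + \<Gamma> u * t powr (\<gamma> - \<upsilon>)" for t
  have ray: "J (t *\<^sub>R u) = t powr \<upsilon> * (\<Upsilon> u + k t)" if "t > 0" for t
    using J_ray[OF that] by (simp add: k_def)
  have "min (k x) (k z) < k y"
    unfolding k_def using exponents xyz P_pos[OF u] by (intro powr_sum_quasi_concave) auto
  moreover have "\<Upsilon> u + k x \<ge> 0" "\<Upsilon> u + k z \<ge> 0"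
    using J ray[of x] ray[of z] xyz by (auto simp: zero_le_mult_iff)
  ultimately have "\<Upsilon> u + k y > 0" by (auto simp: min_def split: if_splits)
  then show ?thesis using ray[of y] xyz by simp
qed

lemma powr_tendsto_0_at_right: "p > 0 \<Longrightarrow> ((\<lambda>t::real. t powr p) \<longlongrightarrow> 0) (at_right 0)"
  by (rule tendsto_zero_powrI[where b = p])
    (auto intro!: tendsto_intros eventually_at_right_less eventually_mono[OF eventually_at_right_less])

lemma J_ray_neg_near_0:
  assumes "\<Upsilon> u < 0"
  obtains d where "d > 0" "\<And>t. 0 < t \<Longrightarrow> t < d \<Longrightarrow> J (t *\<^sub>R u) < 0"
proof -
  have "((\<lambda>t. \<Upsilon> u + (P u * t powr (\<kappa> - \<upsilon>) + \<Gamma> u * t powr (\<gamma> - \<upsilon>))) \<longlongrightarrow>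
      \<Upsilon> u + (P u * 0 + \<Gamma> u * 0)) (at_right 0)"
    using exponents by (intro tendsto_intros powr_tendsto_0_at_right) auto
  then have "\<forall>\<^sub>F t in at_right 0. \<Upsilon> u + (P u * t powr (\<kappa> - \<upsilon>) + \<Gamma> u * t powr (\<gamma> - \<upsilon>)) < 0"
    using assms by (intro order_tendstoD(2)[where y = "\<Upsilon> u + (P u * 0 + \<Gamma> u * 0)"]) auto
  then obtain d where d: "d > 0"
    "\<And>t. 0 < t \<Longrightarrow> t < d \<Longrightarrow> \<Upsilon> u + (P u * t powr (\<kappa> - \<upsilon>) + \<Gamma> u * t powr (\<gamma> - \<upsilon>)) < 0"
    unfolding eventually_at_right_field by auto
  show thesis
  proof
    show "J (t *\<^sub>R u) < 0" if "0 < t" "t < d" for t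
      using d(2)[OF that] that(1) by (simp add: J_ray mult_pos_neg)
  qed (rule d)
qed

lemma J_ray_pos_small:
  assumes "u \<noteq> 0" "\<Upsilon> u \<ge> 0"
  shows "\<exists>r>0. J (r *\<^sub>R u) > 0"
proof -
  have "((\<lambda>t. P u + \<Gamma> u * t powr (\<gamma> - \<kappa>)) \<longlongrightarrow> P u + \<Gamma> u * 0) (at_right 0)"
    using exponents by (intro tendsto_intros powr_tendsto_0_at_right) auto
  then have "\<forall>\<^sub>F t in at_right 0. P u + \<Gamma> u * t powr (\<gamma> - \<kappa>) > 0"
    using P_pos[OF assms(1)] by (intro order_tendstoD(1)[where y = "P u + \<Gamma> u * 0"]) auto
  then have "\<forall>\<^sub>F t in at_right (0::real). t > 0 \<and> P u + \<Gamma> u * t powr (\<gamma> - \<kappa>) > 0"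
    by (intro eventually_conj eventually_at_right_less)
  then obtain t :: real where t: "t > 0" "P u + \<Gamma> u * t powr (\<gamma> - \<kappa>) > 0"
    using eventually_happens by (metis (no_types, lifting) trivial_limit_at_right_real)
  have "J (t *\<^sub>R u) = t powr \<kappa> * (P u + \<Gamma> u * t powr (\<gamma> - \<kappa>)) + t powr \<upsilon> * \<Upsilon> u"
    unfolding J_def scale[OF t(1)] by (simp add: algebra_simps flip: powr_add)
  also have "\<dots> > 0" using t assms by (intro add_pos_nonneg) auto
  finally show ?thesis using t by blast
qed

lemma J_ray_pos_large:
  assumes "u \<noteq> 0" "\<Gamma> u \<ge> 0"
  shows "\<exists>r>0. J (r *\<^sub>R u) > 0"
proof -
  define r where "r = ((\<bar>\<Upsilon> u\<bar> + 1) / P u) powr (1 / (\<kappa> - \<upsilon>))"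
  have P: "P u > 0" using assms P_pos by simp
  have r: "r > 0" using P by (simp add: r_def add_nonneg_pos)
  have "r powr (\<kappa> - \<upsilon>) = (\<bar>\<Upsilon> u\<bar> + 1) / P u"
    using exponents P by (simp add: r_def powr_powr)
  then have "P u * r powr (\<kappa> - \<upsilon>) = \<bar>\<Upsilon> u\<bar> + 1" using P by simp
  moreover have "\<Gamma> u * r powr (\<gamma> - \<upsilon>) \<ge> 0" using assms by simp
  ultimately have "\<Upsilon> u + (P u * r powr (\<kappa> - \<upsilon>) + \<Gamma> u * r powr (\<gamma> - \<upsilon>)) > 0" by linarith
  then show ?thesis using r J_ray[OF r, of u] by (metis mult_pos_pos powr_gt_zero less_irrefl)
qed

lemma J_ray_neg_large:
  assumes "\<Gamma> u < 0"
  obtains z where "z > x" "J (z *\<^sub>R u) < 0"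
proof -
  have "((\<lambda>t. P u * t powr (\<kappa> - \<gamma>) + \<Upsilon> u * t powr (\<upsilon> - \<gamma>) + \<Gamma> u) \<longlongrightarrow>
      P u * 0 + \<Upsilon> u * 0 + \<Gamma> u) at_top"
    using exponents by (intro tendsto_intros tendsto_neg_powr filterlim_ident) auto
  then have "\<forall>\<^sub>F t in at_top. P u * t powr (\<kappa> - \<gamma>) + \<Upsilon> u * t powr (\<upsilon> - \<gamma>) + \<Gamma> u < 0"
    using assms by (intro order_tendstoD(2)[where y = "P u * 0 + \<Upsilon> u * 0 + \<Gamma> u"]) auto
  then have "\<forall>\<^sub>F t in at_top. max x 0 < t \<and>
      P u * t powr (\<kappa> - \<gamma>) + \<Upsilon> u * t powr (\<upsilon> - \<gamma>) + \<Gamma> u < 0"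
    by (intro eventually_conj eventually_gt_at_top)
  then obtain t :: real where t: "t > max x 0"
      "P u * t powr (\<kappa> - \<gamma>) + \<Upsilon> u * t powr (\<upsilon> - \<gamma>) + \<Gamma> u < 0"
    using eventually_happens by (metis (no_types, lifting) trivial_limit_at_top_linorder)
  then have "t > 0" by simp
  have "J (t *\<^sub>R u) =
      t powr \<gamma> * (P u * t powr (\<kappa> - \<gamma>) + \<Upsilon> u * t powr (\<upsilon> - \<gamma>) + \<Gamma> u)"
    unfolding J_def scale[OF \<open>t > 0\<close>] by (simp add: algebra_simps flip: powr_add)
  also have "\<dots> < 0" using t \<open>t > 0\<close> by (intro mult_pos_neg) auto
  finally show thesis using that[of t] t by simp
qed

text \<open>The minimum of \<open>\<Phi>\<close> over the segment from \<open>0\<close> to \<open>\<tau> u\<close> is negative, because \<open>\<Phi>\<close> decreases near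
  \<open>0\<close>, where \<open>\<Upsilon>\<close> dominates.  It is a zero of \<open>J\<close>, also if it is attained at the end point, where
  \<open>J \<ge> 0\<close>.  If \<open>J\<close> were positive somewhere before the minimum, it would stay positive up to it, and
  \<open>\<Phi>\<close> would increase towards its minimum.\<close>

lemma fiber_minimum:
  assumes \<Upsilon>: "\<Upsilon> u < 0" and \<tau>: "\<tau> > 0" "J (\<tau> *\<^sub>R u) \<ge> 0"
  obtains t where "0 < t" "t \<le> \<tau>" "J (t *\<^sub>R u) = 0" "\<Phi> (t *\<^sub>R u) < 0"
    "\<And>r. 0 < r \<Longrightarrow> r \<le> \<tau> \<Longrightarrow> \<Phi> (t *\<^sub>R u) \<le> \<Phi> (r *\<^sub>R u)"
    "\<And>r. 0 < r \<Longrightarrow> r \<le> t \<Longrightarrow> J (r *\<^sub>R u) \<le> 0"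
proof -
  have u: "u \<noteq> 0" using \<Upsilon> zero_values by auto
  obtain t where t: "t \<in> {0..\<tau>}" and "\<forall>r\<in>{0..\<tau>}. \<Phi> (t *\<^sub>R u) \<le> \<Phi> (r *\<^sub>R u)"
    using continuous_attains_inf[OF _ _ continuous_ray(1), of "{0..\<tau>}" u] \<tau> by auto
  then have min: "\<And>r. 0 \<le> r \<Longrightarrow> r \<le> \<tau> \<Longrightarrow> \<Phi> (t *\<^sub>R u) \<le> \<Phi> (r *\<^sub>R u)" by auto
  obtain d where d: "d > 0" "\<And>s. 0 < s \<Longrightarrow> s < d \<Longrightarrow> J (s *\<^sub>R u) < 0"
    using J_ray_neg_near_0[OF \<Upsilon>] by blast
  define s where "s = min \<tau> (d/2)"
  have s: "0 < s" "s \<le> \<tau>" "s < d" using \<tau> d(1) by (auto simp: s_def)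
  have "\<Phi> (s *\<^sub>R u) < \<Phi> (0 *\<^sub>R u)"
  proof (rule DERIV_neg_imp_decreasing_open[OF s(1) _ continuous_ray(1)])
    fix r assume "0 < r" "r < s"
    then show "\<exists>y. ((\<lambda>r. \<Phi> (r *\<^sub>R u)) has_real_derivative y) (at r) \<and> y < 0"
      using DERIV_\<Phi>_ray[of r u] d(2)[of r] s
      by (intro exI[of _ "J (r *\<^sub>R u) / r"]) (simp add: divide_neg_pos)
  qed
  then have neg: "\<Phi> (t *\<^sub>R u) < 0" using min[of s] s \<Phi>_zero by simp
  then have "t \<noteq> 0" using \<Phi>_zero by auto
  with t have t: "0 < t" "t \<le> \<tau>" by auto
  have J0: "J (t *\<^sub>R u) = 0"
  proof (rule ccontr)
    assume "J (t *\<^sub>R u) \<noteq> 0"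
    moreover have "t < \<tau>" if "J (t *\<^sub>R u) < 0"
      using that \<tau> t by (cases "t = \<tau>") auto
    ultimately consider "J (t *\<^sub>R u) > 0" | "J (t *\<^sub>R u) < 0" "t < \<tau>"
      by (metis linorder_neqE_linordered_idom)
    then show False
    proof cases
      case 1
      then obtain e where e: "e > 0" "\<And>h. 0 < h \<Longrightarrow> h < e \<Longrightarrow> \<Phi> ((t - h) *\<^sub>R u) < \<Phi> (t *\<^sub>R u)"
        using DERIV_pos_inc_left[OF DERIV_\<Phi>_ray[OF t(1)], of u] t by (auto simp: field_simps)
      define h where "h = min t e / 2"
      have "0 < h" "h < e" "h < t" using e t by (auto simp: h_def)
      then show False using e(2)[of h] min[of "t - h"] t by simp
    next
      case 2
      then obtain e where e: "e > 0" "\<And>h. 0 < h \<Longrightarrow> h < e \<Longrightarrow> \<Phi> ((t + h) *\<^sub>R u) < \<Phi> (t *\<^sub>R u)"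
        using DERIV_neg_dec_right[OF DERIV_\<Phi>_ray[OF t(1)], of u] t by (auto simp: field_simps)
      define h where "h = min (\<tau> - t) e / 2"
      have "0 < h" "h < e" "h < \<tau> - t" using e 2 by (auto simp: h_def)
      then show False using e(2)[of h] min[of "t + h"] t by simp
    qed
  qed
  show thesis
  proof (rule that[OF t J0 neg])
    show "\<Phi> (t *\<^sub>R u) \<le> \<Phi> (r *\<^sub>R u)" if "0 < r" "r \<le> \<tau>" for r
      using min[of r] that by simp
    show "J (r *\<^sub>R u) \<le> 0" if r: "0 < r" "r \<le> t" for r
    proof (rule ccontr)
      assume *: "\<not> J (r *\<^sub>R u) \<le> 0"
      then have "r < t" using r J0 by (cases "r = t") auto
      have "\<Phi> (r *\<^sub>R u) < \<Phi> (t *\<^sub>R u)"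
        using * r J0 \<open>r < t\<close>
        by (intro \<Phi>_ray_strict_increasing J_ray_pos_between[OF u, of r _ t]) auto
      then show False using min[of r] r t by simp
    qed
  qed
qed

section \<open>Coercivity on the Nehari set\<close>

text \<open>\<open>E\<close> is what \<open>\<Phi>\<close> becomes when \<open>\<Gamma>\<close> is eliminated by \<open>J = 0\<close>.  Its coefficients are positive, so it
  is again weakly lower semicontinuous, and \<open>P\<close> dominates \<open>\<Upsilon>\<close> at infinity.\<close>

definition E :: "'a \<Rightarrow> real" where "E u = (1/\<kappa> - 1/\<gamma>) * P u + (1/\<upsilon> - 1/\<gamma>) * \<Upsilon> u"

lemma exponent_gaps: "1/\<kappa> - 1/\<gamma> > 0" "1/\<upsilon> - 1/\<gamma> > 0"
  using exponents by (auto simp: field_simps)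

lemma \<Phi>_eq_E:
  assumes "J u = 0" shows "\<Phi> u = E u"
proof -
  have "\<Gamma> u = - P u - \<Upsilon> u" using assms by (simp add: J_def)
  then show ?thesis
    by (simp only: \<Phi>_def E_def) (simp add: algebra_simps diff_divide_distrib)
qed

lemma \<Phi>_pos_on_nehari:
  assumes "J u = 0" "u \<noteq> 0" "\<Upsilon> u \<ge> 0" shows "\<Phi> u > 0"
  unfolding \<Phi>_eq_E[OF assms(1)] E_def
  using exponent_gaps assms P_pos[of u] by (intro add_pos_nonneg) auto

lemma E_lower: "(1/\<kappa> - 1/\<gamma>) * inverse C * norm u powr \<kappa> - (1/\<upsilon> - 1/\<gamma>) * C * norm u powr \<upsilon> \<le> E u"
proof -
  have "(1/\<kappa> - 1/\<gamma>) * (inverse C * norm u powr \<kappa>) \<le> (1/\<kappa> - 1/\<gamma>) * P u"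
    using exponent_gaps by (intro mult_left_mono P_bound) auto
  moreover have "(1/\<upsilon> - 1/\<gamma>) * (- (C * norm u powr \<upsilon>)) \<le> (1/\<upsilon> - 1/\<gamma>) * \<Upsilon> u"
    using exponent_gaps \<Upsilon>_bound[of u] by (intro mult_left_mono) (auto simp: abs_le_iff)
  ultimately show ?thesis unfolding E_def by (simp add: mult.assoc)
qed

lemma E_coercive:
  obtains R where "R \<ge> 0" "\<And>u. E u \<le> M \<Longrightarrow> norm u \<le> R"
proof -
  obtain R where R: "R \<ge> 0" "\<And>x. x \<ge> 0 \<Longrightarrow>
      (1/\<kappa> - 1/\<gamma>) * inverse C * x powr \<kappa> - (1/\<upsilon> - 1/\<gamma>) * C * x powr \<upsilon> \<le> M \<Longrightarrow> x \<le> R"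
    using powr_difference_coercive[of \<upsilon> \<kappa> "(1/\<kappa> - 1/\<gamma>) * inverse C" "(1/\<upsilon> - 1/\<gamma>) * C" M]
      exponents exponent_gaps C_pos by (smt (verit) mult_pos_pos positive_imp_inverse_positive)
  show thesis
    using that[OF R(1)] R(2) E_lower by (meson norm_ge_zero order_trans)
qed

lemma E_bounded_below:
  obtains m where "\<And>u. m \<le> E u"
proof -
  obtain R where R: "R \<ge> 0" "\<And>u. E u \<le> 0 \<Longrightarrow> norm u \<le> R" using E_coercive[of 0] by blast
  define m where "m = - ((1/\<upsilon> - 1/\<gamma>) * C * R powr \<upsilon>)"
  have "m \<le> 0" using exponent_gaps C_pos by (simp add: m_def)
  have "m \<le> E u" for u
  proof (cases "E u \<le> 0")
    case True
    then have "norm u powr \<upsilon> \<le> R powr \<upsilon>" using R exponents by (intro powr_mono2) auto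
    then have "m \<le> - ((1/\<upsilon> - 1/\<gamma>) * C * norm u powr \<upsilon>)"
      unfolding m_def using exponent_gaps C_pos by (simp add: mult_left_mono)
    also have "\<dots> \<le> E u"
    proof -
      have "0 \<le> (1/\<kappa> - 1/\<gamma>) * inverse C * norm u powr \<kappa>" using exponent_gaps C_pos by simp
      then show ?thesis using E_lower[of u] by linarith
    qed
    finally show ?thesis .
  next
    case False
    with \<open>m \<le> 0\<close> show ?thesis by simp
  qed
  then show thesis by (rule that)
qed

lemma bdd_below_\<Phi>:
  assumes "\<And>u. u \<in> S \<Longrightarrow> J u = 0" shows "bdd_below (\<Phi> ` S)"
proof -
  obtain m where "\<And>u. m \<le> E u" using E_bounded_below by blast
  then show ?thesis by (intro bdd_belowI2[of _ m]) (simp add: \<Phi>_eq_E assms)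
qed

end

locale fibered_sum = homogeneous_sum P \<Upsilon> \<Gamma> \<kappa> \<upsilon> \<gamma> C
  for P \<Upsilon> \<Gamma> :: "'a::real_normed_vector \<Rightarrow> real" and \<kappa> \<upsilon> \<gamma> C :: real +
  assumes reflexive: "reflexive_space TYPE('a)"
    and wlsc: "weakly_lsc P" "weakly_lsc \<Upsilon>" "weakly_lsc \<Gamma>"
    and fibering: "\<And>u. \<Upsilon> u < 0 \<Longrightarrow> \<Gamma> u < 0 \<Longrightarrow>
      \<exists>t s. 0 < t \<and> t < s \<and>
        {r. r > 0 \<and> critical_point (\<lambda>r. \<Phi> (r *\<^sub>R u)) r} = {t, s} \<and>
        local_minimizer (\<lambda>r. \<Phi> (r *\<^sub>R u)) t"
begin

text \<open>If \<open>\<Upsilon> u\<close> and \<open>\<Gamma> u\<close> are negative, the local minimum of the fibering map at \<open>t\<close> and the mean value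
  theorem give points just after \<open>t\<close> with \<open>J \<ge> 0\<close>, and \<open>J\<close> vanishes nowhere between \<open>t\<close> and \<open>s\<close>.
  Otherwise \<open>P\<close> dominates near \<open>0\<close> (if \<open>\<Upsilon> u \<ge> 0\<close>) or at infinity compared with \<open>\<Upsilon>\<close> (if \<open>\<Gamma> u \<ge> 0\<close>).\<close>

lemma J_ray_pos:
  assumes u: "u \<noteq> 0"
  obtains r where "r > 0" "J (r *\<^sub>R u) > 0"
proof -
  have "\<exists>r>0. J (r *\<^sub>R u) > 0" if neg: "\<Upsilon> u < 0" "\<Gamma> u < 0"
  proof -
    let ?\<phi> = "\<lambda>r. \<Phi> (r *\<^sub>R u)"
    obtain t s where ts: "0 < t" "t < s"
      and crit: "{r. r > 0 \<and> critical_point ?\<phi> r} = {t, s}" and min: "local_minimizer ?\<phi> t"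
      using fibering[OF neg] by blast
    obtain d where d: "d > 0" "\<And>r. dist r t < d \<Longrightarrow> ?\<phi> t \<le> ?\<phi> r"
      using min unfolding local_minimizer_def eventually_nhds_metric by blast
    define z where "z = min s (t + d / 2)"
    have z: "t < z" "z \<le> s" "dist z t < d" using ts d(1) by (auto simp: z_def dist_real_def)
    have "\<exists>x. t < x \<and> x < z \<and> ?\<phi> z - ?\<phi> t = (z - t) * (J (x *\<^sub>R u) / x)"
      using z ts by (intro MVT2 DERIV_\<Phi>_ray) auto
    then obtain x where x: "t < x" "x < z" "?\<phi> z - ?\<phi> t = (z - t) * (J (x *\<^sub>R u) / x)"
      by blast
    have "(z - t) * (J (x *\<^sub>R u) / x) \<ge> 0" using d(2)[OF z(3)] x(3) by simp
    then have "J (x *\<^sub>R u) \<ge> 0" using z x ts by (auto simp: zero_le_mult_iff zero_le_divide_iff)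
    moreover have "J (x *\<^sub>R u) \<noteq> 0"
    proof
      assume "J (x *\<^sub>R u) = 0"
      then have "critical_point ?\<phi> x"
        using DERIV_\<Phi>_ray[of x u] x ts
        by (simp add: critical_point_def has_field_derivative_def lambda_zero)
      moreover have "x > 0" using x ts by simp
      ultimately have "x \<in> {t, s}" unfolding crit[symmetric] by simp
      then show False using x z by auto
    qed
    ultimately show ?thesis using x ts by (intro exI[of _ x]) auto
  qed
  then show thesis
    using J_ray_pos_small[OF u] J_ray_pos_large[OF u] that
    by (cases "\<Upsilon> u < 0"; cases "\<Gamma> u < 0") auto
qed

lemma weakly_lsc_\<Phi>: "weakly_lsc \<Phi>"
  unfolding \<Phi>_def[abs_def] using exponents
  by (intro weakly_lsc_add weakly_lsc_cmult wlsc) auto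

lemma weakly_lsc_J: "weakly_lsc J"
  unfolding J_def[abs_def] by (intro weakly_lsc_add wlsc)

lemma weakly_lsc_E: "weakly_lsc E"
  unfolding E_def[abs_def] using exponent_gaps
  by (intro weakly_lsc_add weakly_lsc_cmult wlsc) auto

lemma weakly_convergent_minimizing_sequence:
  assumes ne: "S \<noteq> {}" and S: "\<And>u. u \<in> S \<Longrightarrow> J u = 0"
  obtains x u where "\<And>n. x n \<in> S" "weakly_converges x u" "(\<lambda>n. \<Phi> (x n)) \<longlonglongrightarrow> Inf (\<Phi> ` S)"
proof -
  let ?d = "Inf (\<Phi> ` S)"
  have bdd: "bdd_below (\<Phi> ` S)" using S by (rule bdd_below_\<Phi>)
  have "\<forall>n. \<exists>x\<in>S. \<Phi> x < ?d + inverse (real (Suc n))"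
  proof
    fix n
    show "\<exists>x\<in>S. \<Phi> x < ?d + inverse (real (Suc n))"
      using cInf_lessD[of "\<Phi> ` S" "?d + inverse (real (Suc n))"] ne by auto
  qed
  then obtain y where y: "\<And>n. y n \<in> S" "\<And>n. \<Phi> (y n) < ?d + inverse (real (Suc n))"
    by metis
  have "E (y n) \<le> ?d + 1" for n
    using y(2)[of n] \<Phi>_eq_E[OF S[OF y(1)], of n] inverse_le_1_iff[of "real (Suc n)"] by simp
  then obtain M where "\<And>n. norm (y n) \<le> M" using E_coercive by metis
  then obtain r u where r: "strict_mono r" "weakly_converges (y \<circ> r) u"
    using reflexive_bounded_imp_weakly_convergent_subseq[OF reflexive] by blast
  have "(\<lambda>n. \<Phi> (y n)) \<longlonglongrightarrow> ?d"
  proof (rule tendsto_sandwich)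
    show "\<forall>\<^sub>F n in sequentially. ?d \<le> \<Phi> (y n)"
      using y(1) by (intro always_eventually allI cINF_lower[OF bdd])
    show "\<forall>\<^sub>F n in sequentially. \<Phi> (y n) \<le> ?d + inverse (real (Suc n))"
      using y(2) by (intro always_eventually) (auto intro: less_imp_le)
    show "(\<lambda>n. ?d + inverse (real (Suc n))) \<longlonglongrightarrow> ?d"
      using tendsto_add[OF tendsto_const LIMSEQ_inverse_real_of_nat, of ?d] by simp
  qed simp
  then have "(\<lambda>n. \<Phi> ((y \<circ> r) n)) \<longlonglongrightarrow> ?d"
    using LIMSEQ_subseq_LIMSEQ[OF _ r(1)] by (fastforce simp: o_def)
  then show thesis using that[of "y \<circ> r" u] y(1) r(2) by simp
qed

section \<open>The ground state\<close>

text \<open>On each ray in \<open>\<Upsilon> < 0\<close> the minimum of \<open>\<Phi>\<close> over an initial segment ending at a point with \<open>J \<ge> 0\<close>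
  is attained in \<open>S\<close>.  In contrast to \<open>J = 0\<close>, the inequalities
  defining \<open>S\<close> survive weak limits.  The factor \<open>\<sigma>\<close> distinguishes this minimizer from the second
  critical point.\<close>

lemma ground_state_minimizer:
  assumes ne: "\<Upsilon> v < 0"
  obtains u \<sigma> where "J u = 0" "\<Upsilon> u < 0" "\<Phi> u < 0" "\<And>w. J w = 0 \<Longrightarrow> \<Upsilon> w < 0 \<Longrightarrow> \<Phi> u \<le> \<Phi> w"
    "local_minimizer \<Phi> u" "\<sigma> > 1" "J (\<sigma> *\<^sub>R u) > 0"
proof -
  define S where "S = {u. J u = 0 \<and> \<Upsilon> u < 0 \<and> (\<forall>r. 0 < r \<and> r \<le> 1 \<longrightarrow> J (r *\<^sub>R u) \<le> 0)}"
  define c where "c = Inf (\<Phi> ` S)"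
  have into_S: "\<exists>t. 0 < t \<and> t \<le> \<tau> \<and> t *\<^sub>R u \<in> S \<and> \<Phi> (t *\<^sub>R u) < 0 \<and>
      (\<forall>r. 0 < r \<and> r \<le> \<tau> \<longrightarrow> \<Phi> (t *\<^sub>R u) \<le> \<Phi> (r *\<^sub>R u))"
    if u: "\<Upsilon> u < 0" "\<tau> > 0" "J (\<tau> *\<^sub>R u) \<ge> 0" for u \<tau>
  proof -
    obtain t where t: "0 < t" "t \<le> \<tau>" "J (t *\<^sub>R u) = 0" "\<Phi> (t *\<^sub>R u) < 0"
      "\<And>r. 0 < r \<Longrightarrow> r \<le> \<tau> \<Longrightarrow> \<Phi> (t *\<^sub>R u) \<le> \<Phi> (r *\<^sub>R u)"
      "\<And>r. 0 < r \<Longrightarrow> r \<le> t \<Longrightarrow> J (r *\<^sub>R u) \<le> 0"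
      using fiber_minimum[OF u] by blast
    have "\<Upsilon> (t *\<^sub>R u) < 0" using u(1) t(1) by (simp add: scale mult_pos_neg)
    moreover have "J (r *\<^sub>R t *\<^sub>R u) \<le> 0" if "0 < r" "r \<le> 1" for r
      using t(6)[of "r * t"] t(1) that by (simp add: mult_left_le_one_le)
    ultimately show ?thesis using t by (auto simp: S_def)
  qed
  have S_J: "J u = 0" if "u \<in> S" for u using that by (simp add: S_def)
  have c_le: "c \<le> \<Phi> u" if "u \<in> S" for u
    unfolding c_def using that by (intro cINF_lower bdd_below_\<Phi> S_J)
  have "v \<noteq> 0" using ne zero_values by auto
  then obtain r where "r > 0" "J (r *\<^sub>R v) > 0" by (rule J_ray_pos)
  then obtain v' where v': "v' \<in> S" "\<Phi> v' < 0" using into_S[of v r] ne by force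
  then have "S \<noteq> {}" "c < 0" using c_le[of v'] by auto
  then obtain x u where x: "\<And>n. x n \<in> S" "weakly_converges x u" "(\<lambda>n. \<Phi> (x n)) \<longlonglongrightarrow> c"
    unfolding c_def using weakly_convergent_minimizing_sequence[OF _ S_J] by blast
  have \<Phi>_u: "\<Phi> u \<le> c"
    by (rule weakly_lsc_limit_le[OF weakly_lsc_\<Phi> x(2) _ x(3)]) simp
  \<comment> \<open>A weak limit might leave \<open>J = 0\<close>, where \<open>\<Phi> = E\<close>; so the bound is derived for \<open>E\<close> separately.\<close>
  have "E u \<le> c"
    using x(1) by (intro weakly_lsc_limit_le[OF weakly_lsc_E x(2) _ x(3)]) (simp add: \<Phi>_eq_E S_J)
  then have "(1/\<upsilon> - 1/\<gamma>) * \<Upsilon> u < 0"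
    using \<open>c < 0\<close> mult_nonneg_nonneg[of "1/\<kappa> - 1/\<gamma>" "P u"] exponent_gaps P_nonneg[of u]
    unfolding E_def by linarith
  then have \<Upsilon>_u: "\<Upsilon> u < 0" using exponent_gaps by (simp add: mult_less_0_iff)
  have J_u: "J (r *\<^sub>R u) \<le> 0" if r: "0 < r" "r \<le> 1" for r
    using x(1) r
    by (intro weakly_lsc_limit_le[OF weakly_lsc_J weakly_converges_scaleR[OF x(2)] _ tendsto_const])
      (simp add: S_def)
  have "u \<noteq> 0" using \<Upsilon>_u zero_values by auto
  then obtain \<tau> where \<tau>: "\<tau> > 0" "J (\<tau> *\<^sub>R u) > 0" by (rule J_ray_pos)
  then have "\<tau> > 1" using J_u[of \<tau>] by force
  obtain t where t: "0 < t" "t \<le> \<tau>" "t *\<^sub>R u \<in> S"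
    "\<And>r. 0 < r \<Longrightarrow> r \<le> \<tau> \<Longrightarrow> \<Phi> (t *\<^sub>R u) \<le> \<Phi> (r *\<^sub>R u)"
    using into_S[of u \<tau>] \<Upsilon>_u \<tau> by force
  have \<Phi>_t: "\<Phi> (t *\<^sub>R u) = c"
    using t(4)[of 1] \<open>\<tau> > 1\<close> \<Phi>_u c_le[OF t(3)] by simp
  have t_ne: "t \<noteq> \<tau>" using \<tau>(2) S_J[OF t(3)] by auto
  define \<sigma> where "\<sigma> = \<tau> / t"
  have \<sigma>: "\<sigma> > 1" "J (\<sigma> *\<^sub>R t *\<^sub>R u) > 0" using t t_ne \<tau> by (auto simp: \<sigma>_def)
  \<comment> \<open>With \<open>\<tau> = r = 1\<close> this is minimality on \<open>J = 0\<close>, with \<open>\<tau> = \<sigma>\<close>, \<open>r = 1\<close> local minimality.\<close>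
  have c_le': "c \<le> \<Phi> (r *\<^sub>R w)" if w: "\<Upsilon> w < 0" "J (\<tau> *\<^sub>R w) \<ge> 0" "0 < r" "r \<le> \<tau>" for w r \<tau>
    using into_S[of w \<tau>] w c_le by (meson less_le_trans order_trans)
  show thesis
  proof (rule that[OF _ _ _ _ _ \<sigma>])
    show "J (t *\<^sub>R u) = 0" "\<Upsilon> (t *\<^sub>R u) < 0" using t(3) by (auto simp: S_def)
    show "\<Phi> (t *\<^sub>R u) < 0" using \<Phi>_t \<open>c < 0\<close> by simp
    show "\<Phi> (t *\<^sub>R u) \<le> \<Phi> w" if "J w = 0" "\<Upsilon> w < 0" for w
      using c_le'[of w 1 1] that \<Phi>_t by simp
    show "local_minimizer \<Phi> (t *\<^sub>R u)"
      unfolding local_minimizer_def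
    proof -
      have "((\<lambda>w. J (\<sigma> *\<^sub>R w)) \<longlongrightarrow> J (\<sigma> *\<^sub>R t *\<^sub>R u)) (nhds (t *\<^sub>R u))"
        by (rule isCont_tendsto_compose[OF isCont_functionals(3)]) (intro tendsto_intros filterlim_ident)
      then have "\<forall>\<^sub>F w in nhds (t *\<^sub>R u). J (\<sigma> *\<^sub>R w) > 0"
        using \<sigma>(2) by (rule order_tendstoD)
      moreover have "(\<Upsilon> \<longlongrightarrow> \<Upsilon> (t *\<^sub>R u)) (nhds (t *\<^sub>R u))"
        by (rule isCont_tendsto_compose[OF isCont_functionals(1)]) (rule filterlim_ident)
      then have "\<forall>\<^sub>F w in nhds (t *\<^sub>R u). \<Upsilon> w < 0"
        using t(3) by (intro order_tendstoD(2)) (auto simp: S_def)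
      ultimately show "\<forall>\<^sub>F w in nhds (t *\<^sub>R u). \<Phi> (t *\<^sub>R u) \<le> \<Phi> w"
      proof eventually_elim
        case (elim w)
        then show ?case using c_le'[of w \<sigma> 1] \<sigma>(1) \<Phi>_t by simp
      qed
    qed
  qed
qed

section \<open>The second critical point\<close>

text \<open>The points where \<open>J\<close> crosses zero downwards along its ray.\<close>

definition falling_nehari :: "'a set" where
  "falling_nehari = {u. J u = 0 \<and> \<Gamma> u < 0 \<and> (\<forall>r\<ge>1. J (r *\<^sub>R u) \<le> 0)}"

lemma falling_nehari_on_ray:
  assumes v: "\<Gamma> v < 0" and xz: "0 < x" "x < z" and J: "J (x *\<^sub>R v) > 0" "J (z *\<^sub>R v) < 0"
  obtains s where "x < s" "s < z" "s *\<^sub>R v \<in> falling_nehari"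
proof -
  have "v \<noteq> 0" using v zero_values by auto
  have "\<exists>s\<ge>x. s \<le> z \<and> J (s *\<^sub>R v) = 0"
    using J xz by (intro IVT2' continuous_ray) auto
  then obtain s where s: "x \<le> s" "s \<le> z" "J (s *\<^sub>R v) = 0" by blast
  then have strict: "x < s" "s < z" using J by (auto simp: less_le)
  have "J (r *\<^sub>R s *\<^sub>R v) \<le> 0" if "r \<ge> 1" for r
  proof (rule ccontr)
    assume *: "\<not> J (r *\<^sub>R s *\<^sub>R v) \<le> 0"
    then have "r > 1" using s that by (cases "r = 1") auto
    then have "s < r * s" using strict xz by simp
    then have "J (s *\<^sub>R v) > 0"
      using * J strict xz by (intro J_ray_pos_between[OF \<open>v \<noteq> 0\<close>, of x s "r * s"]) auto
    then show False using s by simp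
  qed
  moreover have "\<Gamma> (s *\<^sub>R v) < 0" using v strict xz by (simp add: scale mult_pos_neg)
  ultimately show thesis using that[OF strict] s by (simp add: falling_nehari_def)
qed

text \<open>The derivative of \<open>J (r u)\<close> at \<open>r = 1\<close> is \<open>\<kappa> P u + \<upsilon> \<Upsilon> u + \<gamma> \<Gamma> u\<close>, and it cannot be positive;
  eliminating \<open>\<Upsilon> u\<close> by \<open>J u = 0\<close> gives the estimate.\<close>

lemma falling_nehari_\<Gamma>_P:
  assumes "u \<in> falling_nehari"
  shows "(\<kappa> - \<upsilon>) * P u \<le> (\<gamma> - \<upsilon>) * - \<Gamma> u"
proof -
  have J0: "J u = 0" using assms by (simp add: falling_nehari_def)
  have "((\<lambda>r. J (r *\<^sub>R u)) has_real_derivative \<kappa> * P u + \<upsilon> * \<Upsilon> u + \<gamma> * \<Gamma> u) (at 1)"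
  proof (rule has_field_derivative_transform_within_open[where S = "{0<..}"])
    show "((\<lambda>r. r powr \<kappa> * P u + r powr \<upsilon> * \<Upsilon> u + r powr \<gamma> * \<Gamma> u) has_real_derivative
        \<kappa> * P u + \<upsilon> * \<Upsilon> u + \<gamma> * \<Gamma> u) (at 1)"
      by (auto intro!: derivative_eq_intros)
  qed (auto simp: J_def scale)
  moreover have "\<not> \<kappa> * P u + \<upsilon> * \<Upsilon> u + \<gamma> * \<Gamma> u > 0"
  proof
    assume "\<kappa> * P u + \<upsilon> * \<Upsilon> u + \<gamma> * \<Gamma> u > 0"
    then obtain d where d: "d > 0" "\<And>h. 0 < h \<Longrightarrow> h < d \<Longrightarrow> J (1 *\<^sub>R u) < J ((1 + h) *\<^sub>R u)"
      using DERIV_pos_inc_right[OF calculation] by blast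
    then have "J u < J ((1 + d/2) *\<^sub>R u)" using d(2)[of "d/2"] by simp
    moreover have "J ((1 + d/2) *\<^sub>R u) \<le> 0" using assms d(1) by (simp add: falling_nehari_def)
    ultimately show False using J0 by simp
  qed
  moreover have "\<Upsilon> u = - P u - \<Gamma> u" using J0 by (simp add: J_def)
  ultimately show ?thesis by (simp add: algebra_simps)
qed

text \<open>\<open>k P u \<le> - \<Gamma> u\<close> and the growth bounds give \<open>k \<parallel>u\<parallel>\<^sup>\<kappa> \<le> C\<^sup>2 \<parallel>u\<parallel>\<^sup>\<gamma>\<close>, so \<open>\<parallel>u\<parallel> \<ge> \<rho>\<close> as \<open>\<kappa> < \<gamma>\<close>.  The uniform
  bound on \<open>\<Gamma>\<close> keeps weak limits away from \<open>\<Gamma> = 0\<close>.\<close>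

lemma falling_nehari_\<Gamma>_bound:
  obtains c where "c > 0" "\<And>u. u \<in> falling_nehari \<Longrightarrow> \<Gamma> u \<le> - c"
proof -
  define k where "k = (\<kappa> - \<upsilon>) / (\<gamma> - \<upsilon>)"
  define \<rho> where "\<rho> = (k / C\<^sup>2) powr (1 / (\<gamma> - \<kappa>))"
  have k: "k > 0" using exponents by (simp add: k_def)
  have \<rho>: "\<rho> > 0" using k C_pos by (simp add: \<rho>_def)
  show thesis
  proof
    show "k * inverse C * \<rho> powr \<kappa> > 0" using k \<rho> C_pos by simp
    fix u assume u: "u \<in> falling_nehari"
    have "u \<noteq> 0" using u zero_values by (auto simp: falling_nehari_def)
    have "k * P u \<le> - \<Gamma> u"
      using falling_nehari_\<Gamma>_P[OF u] exponents by (simp add: k_def field_simps)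
    then have *: "k * (inverse C * norm u powr \<kappa>) \<le> - \<Gamma> u"
      using mult_left_mono[OF P_bound[of u], of k] k by linarith
    also have "\<dots> \<le> C * norm u powr \<gamma>" using \<Gamma>_bound[of u] by simp
    also have "norm u powr \<gamma> = norm u powr \<kappa> * norm u powr (\<gamma> - \<kappa>)" by (simp flip: powr_add)
    finally have "k / C\<^sup>2 \<le> norm u powr (\<gamma> - \<kappa>)"
      using \<open>u \<noteq> 0\<close> C_pos by (simp add: field_simps power2_eq_square)
    then have "\<rho> \<le> (norm u powr (\<gamma> - \<kappa>)) powr (1 / (\<gamma> - \<kappa>))"
      unfolding \<rho>_def using k C_pos exponents by (intro powr_mono2) auto
    also have "\<dots> = norm u" using exponents by (simp add: powr_powr)
    finally have "\<rho> powr \<kappa> \<le> norm u powr \<kappa>" using \<rho> exponents by (intro powr_mono2) auto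
    then have "k * (inverse C * \<rho> powr \<kappa>) \<le> k * (inverse C * norm u powr \<kappa>)"
      using k C_pos by (intro mult_left_mono) auto
    then show "\<Gamma> u \<le> - (k * inverse C * \<rho> powr \<kappa>)" using * by (simp add: mult.assoc)
  qed
qed

lemma falling_nehari_ray:
  assumes u: "u \<in> falling_nehari" and r: "r > 0" "J (r *\<^sub>R u) > 0"
  shows "r < 1" "\<And>t. r < t \<Longrightarrow> t < 1 \<Longrightarrow> J (t *\<^sub>R u) > 0" "\<And>t. t > 1 \<Longrightarrow> J (t *\<^sub>R u) < 0"
    "\<And>t. t \<ge> r \<Longrightarrow> \<Phi> (t *\<^sub>R u) \<le> \<Phi> u"
proof -
  have u0: "u \<noteq> 0" using u zero_values by (auto simp: falling_nehari_def)
  have J0: "J u = 0" and J1: "\<And>t. t \<ge> 1 \<Longrightarrow> J (t *\<^sub>R u) \<le> 0"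
    using u by (auto simp: falling_nehari_def)
  show r1: "r < 1" using J1[of r] r by (meson not_le)
  show pos: "J (t *\<^sub>R u) > 0" if "r < t" "t < 1" for t
    using J_ray_pos_between[OF u0, of r t 1] that r J0 by simp
  show "J (t *\<^sub>R u) < 0" if "t > 1" for t
    using J_ray_pos_between[OF u0, of r 1 t] that r r1 J0 by (force simp: not_less[symmetric])
  show "\<Phi> (t *\<^sub>R u) \<le> \<Phi> u" if t: "t \<ge> r" for t
  proof (cases "t < 1")
    case True
    then have "\<Phi> (t *\<^sub>R u) < \<Phi> (1 *\<^sub>R u)"
      using t r pos by (intro \<Phi>_ray_strict_increasing) auto
    then show ?thesis by simp
  next
    case False
    then have "\<Phi> (t *\<^sub>R u) \<le> \<Phi> (1 *\<^sub>R u)"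
      using J1 by (intro \<Phi>_ray_decreasing) auto
    then show ?thesis by simp
  qed
qed

text \<open>Lower semicontinuity alone bounds \<open>\<Phi>\<close> only at the weak limit \<open>v\<close>, which may fail \<open>J v = 0\<close>.
  Instead the bound is transported along rays: \<open>J (r v) > 0\<close> is inherited by \<open>x n\<close>, which places \<open>r\<close>
  on the rising part of the ray of \<open>x n\<close>, and beyond \<open>r\<close> the value \<open>\<Phi> (x n)\<close> is the maximum.\<close>

lemma falling_nehari_minimizer:
  assumes "\<Gamma> v0 < 0"
  obtains w where "w \<in> falling_nehari" "\<And>v. v \<in> falling_nehari \<Longrightarrow> \<Phi> w \<le> \<Phi> v"
proof -
  have ray: "\<exists>s. r < s \<and> s *\<^sub>R v \<in> falling_nehari"
    if v: "\<Gamma> v < 0" "r > 0" "J (r *\<^sub>R v) > 0" for v r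
  proof -
    obtain z where "z > r" "J (z *\<^sub>R v) < 0" using J_ray_neg_large[OF v(1)] by metis
    then show ?thesis using falling_nehari_on_ray[OF v(1,2) _ v(3), of z] by metis
  qed
  have pos: "\<exists>r>0. J (r *\<^sub>R v) > 0" if "\<Gamma> v < 0" for v
    using that zero_values J_ray_pos[of v] by (metis less_irrefl)
  have N: "J u = 0" if "u \<in> falling_nehari" for u using that by (simp add: falling_nehari_def)
  have "falling_nehari \<noteq> {}" using pos[OF assms] ray[OF assms] by blast
  then obtain x v where x: "\<And>n. x n \<in> falling_nehari" "weakly_converges x v"
    "(\<lambda>n. \<Phi> (x n)) \<longlonglongrightarrow> Inf (\<Phi> ` falling_nehari)"
    using weakly_convergent_minimizing_sequence[OF _ N] by blast
  obtain k where k: "k > 0" "\<And>u. u \<in> falling_nehari \<Longrightarrow> \<Gamma> u \<le> - k"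
    using falling_nehari_\<Gamma>_bound by blast
  have "\<Gamma> v \<le> - k"
    using k(2) x(1) by (intro weakly_lsc_limit_le[OF wlsc(3) x(2) _ tendsto_const]) simp
  then have v: "\<Gamma> v < 0" using k(1) by simp
  obtain r where r: "r > 0" "J (r *\<^sub>R v) > 0" using pos[OF v] by blast
  then obtain s where s: "r < s" "s *\<^sub>R v \<in> falling_nehari" using ray[OF v] by blast
  have "\<forall>\<^sub>F n in sequentially. J (r *\<^sub>R x n) > 0"
    using weakly_lsc_J weakly_converges_scaleR[OF x(2), of r] r(2) unfolding weakly_lsc_iff by blast
  then have "\<forall>\<^sub>F n in sequentially. \<Phi> (s *\<^sub>R x n) \<le> \<Phi> (x n)"
  proof eventually_elim
    case (elim n)
    then show ?case using falling_nehari_ray(4)[OF x(1) r(1)] s(1) by simp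
  qed
  then have "\<Phi> (s *\<^sub>R v) \<le> Inf (\<Phi> ` falling_nehari)"
    by (rule weakly_lsc_limit_le[OF weakly_lsc_\<Phi> weakly_converges_scaleR[OF x(2)] _ x(3)])
  moreover have "Inf (\<Phi> ` falling_nehari) \<le> \<Phi> u" if "u \<in> falling_nehari" for u
    using that by (intro cINF_lower bdd_below_\<Phi> N)
  ultimately show thesis using that[OF s(2)] by (meson order_trans)
qed

text \<open>If \<open>\<Phi>' (w) h < 0\<close>, then \<open>\<Phi> (s (w + e h)) < \<Phi> (s w) \<le> \<Phi> w\<close> for all \<open>s\<close> near \<open>1\<close> and small
  \<open>e > 0\<close>.  The signs of \<open>J\<close> at \<open>(1 \<plusminus> \<delta>) w\<close> persist at \<open>(1 \<plusminus> \<delta>) (w + e h)\<close>, so some such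
  \<open>s (w + e h)\<close> lies in the set over which \<open>w\<close> minimizes.\<close>

lemma falling_nehari_minimizer_critical:
  assumes w: "w \<in> falling_nehari" and min: "\<And>v. v \<in> falling_nehari \<Longrightarrow> \<Phi> w \<le> \<Phi> v"
  shows "critical_point \<Phi> w"
proof -
  obtain \<Phi>' :: "'a \<Rightarrow> 'a \<Rightarrow>\<^sub>L real" where
    deriv: "\<And>u. (\<Phi> has_derivative \<Phi>' u) (at u)" and cont: "continuous_on UNIV \<Phi>'"
    using \<Phi>_C1 by blast
  have w0: "w \<noteq> 0" "\<Gamma> w < 0" using w zero_values by (auto simp: falling_nehari_def)
  obtain r where r: "r > 0" "J (r *\<^sub>R w) > 0" using J_ray_pos[OF w0(1)] by blast
  note ray = falling_nehari_ray[OF w r]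
  have "\<Phi>' w h = 0" for h
  proof (rule ccontr)
    assume "\<Phi>' w h \<noteq> 0"
    then obtain h where h: "\<Phi>' w h < 0"
      by (metis blinfun.minus_right linorder_neqE_linordered_idom neg_less_0_iff_less)
    have "isCont \<Phi>' w" using cont by (simp add: continuous_on_eq_continuous_at)
    then have "(\<Phi>' \<longlongrightarrow> \<Phi>' w) (nhds w)" by (simp add: isCont_def tendsto_at_iff_tendsto_nhds)
    then have "((\<lambda>x. \<Phi>' x h) \<longlongrightarrow> \<Phi>' w h) (nhds w)" by (intro tendsto_intros)
    then have "\<forall>\<^sub>F x in nhds w. \<Phi>' x h < 0" using h by (rule order_tendstoD)
    then obtain \<rho> where \<rho>: "\<rho> > 0" "\<And>x. dist x w < \<rho> \<Longrightarrow> \<Phi>' x h < 0"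
      unfolding eventually_nhds_metric by blast
    \<comment> \<open>One half of the distance budget \<open>\<rho>\<close> is spent on scaling by \<open>s\<close>, the other on the shift by \<open>e h\<close>.\<close>
    define \<delta> where "\<delta> = min (1 - r) (\<rho> / (2 * norm w)) / 2"
    have \<delta>: "\<delta> > 0" "r < 1 - \<delta>" "\<delta> * norm w < \<rho> / 2"
      using ray(1) \<rho>(1) w0(1) by (auto simp: \<delta>_def min_def field_simps)
    have lim: "((\<lambda>e. H (s *\<^sub>R (w + e *\<^sub>R h))) \<longlongrightarrow> H (s *\<^sub>R w)) (at_right 0)"
      if "\<And>u. isCont H u" for H :: "'a \<Rightarrow> real" and s
    proof (rule isCont_tendsto_compose[OF that])
      have "((\<lambda>e. s *\<^sub>R (w + e *\<^sub>R h)) \<longlongrightarrow> s *\<^sub>R (w + 0 *\<^sub>R h)) (at_right 0)"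
        by (intro tendsto_intros)
      then show "((\<lambda>e. s *\<^sub>R (w + e *\<^sub>R h)) \<longlongrightarrow> s *\<^sub>R w) (at_right 0)" by simp
    qed
    have "\<forall>\<^sub>F e in at_right 0. J ((1 - \<delta>) *\<^sub>R (w + e *\<^sub>R h)) > 0"
      using \<delta> ray(2)[of "1 - \<delta>"] by (intro order_tendstoD(1)[OF lim] isCont_functionals) auto
    moreover have "\<forall>\<^sub>F e in at_right 0. J ((1 + \<delta>) *\<^sub>R (w + e *\<^sub>R h)) < 0"
      using \<delta> ray(3)[of "1 + \<delta>"] by (intro order_tendstoD(2)[OF lim] isCont_functionals) auto
    moreover have "\<forall>\<^sub>F e in at_right 0. \<Gamma> (1 *\<^sub>R (w + e *\<^sub>R h)) < 0"
      using w0(2) by (intro order_tendstoD(2)[OF lim] isCont_functionals) auto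
    moreover have "((\<lambda>e. (1 + \<delta>) * e * norm h) \<longlongrightarrow> (1 + \<delta>) * 0 * norm h) (at_right 0)"
      by (intro tendsto_intros)
    then have "\<forall>\<^sub>F e in at_right 0. (1 + \<delta>) * e * norm h < \<rho> / 2"
      using \<rho>(1) by (intro order_tendstoD(2)[where y = "(1 + \<delta>) * 0 * norm h"]) auto
    moreover have "\<forall>\<^sub>F e in at_right 0. e > (0::real)" by (rule eventually_at_right_less)
    ultimately have "\<forall>\<^sub>F e in at_right 0. e > 0 \<and> J ((1 - \<delta>) *\<^sub>R (w + e *\<^sub>R h)) > 0 \<and>
        J ((1 + \<delta>) *\<^sub>R (w + e *\<^sub>R h)) < 0 \<and> \<Gamma> (w + e *\<^sub>R h) < 0 \<and> (1 + \<delta>) * e * norm h < \<rho> / 2"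
      by eventually_elim simp
    then obtain e where e: "e > 0" "J ((1 - \<delta>) *\<^sub>R (w + e *\<^sub>R h)) > 0"
        "J ((1 + \<delta>) *\<^sub>R (w + e *\<^sub>R h)) < 0" "\<Gamma> (w + e *\<^sub>R h) < 0"
        "(1 + \<delta>) * e * norm h < \<rho> / 2"
      using eventually_happens[of _ "at_right (0::real)"] by (auto simp: trivial_limit_at_right_real)
    have "0 < 1 - \<delta>" "1 - \<delta> < 1 + \<delta>" using \<delta> r by auto
    then obtain s where s: "1 - \<delta> < s" "s < 1 + \<delta>" "s *\<^sub>R (w + e *\<^sub>R h) \<in> falling_nehari"
      using falling_nehari_on_ray[OF e(4) _ _ e(2,3)] by blast
    have "s > 0" using s \<open>0 < 1 - \<delta>\<close> by simp
    define q where "q a = \<Phi> (s *\<^sub>R w + a *\<^sub>R s *\<^sub>R h)" for a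
    have "q 0 > q e"
    proof (rule DERIV_neg_imp_decreasing[OF e(1)])
      fix a assume a: "0 \<le> a" "a \<le> e"
      let ?x = "s *\<^sub>R w + a *\<^sub>R s *\<^sub>R h"
      have "(q has_derivative (\<lambda>b. \<Phi>' ?x (b *\<^sub>R s *\<^sub>R h))) (at a)"
        unfolding q_def
        by (rule has_derivative_compose[OF _ deriv]) (auto intro!: derivative_eq_intros)
      then have "(q has_real_derivative s * \<Phi>' ?x h) (at a)"
        unfolding has_field_derivative_def
        by (rule has_derivative_eq_rhs) (simp add: fun_eq_iff blinfun.scaleR_right)
      moreover have "dist ?x w < \<rho>"
      proof -
        have "dist ?x w = norm ((s - 1) *\<^sub>R w + (a * s) *\<^sub>R h)"
          by (simp add: dist_norm algebra_simps)
        also have "\<dots> \<le> norm ((s - 1) *\<^sub>R w) + norm ((a * s) *\<^sub>R h)" by (rule norm_triangle_ineq)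
        also have "norm ((s - 1) *\<^sub>R w) \<le> \<delta> * norm w"
          using s by (auto intro!: mult_right_mono)
        also have "norm ((a * s) *\<^sub>R h) \<le> (1 + \<delta>) * e * norm h"
          using a s \<open>s > 0\<close> \<delta>(1) by (auto intro!: mult_right_mono mult_mono simp: mult.commute[of a s])
        finally show ?thesis using \<delta>(3) e(5) by simp
      qed
      then have "s * \<Phi>' ?x h < 0" using \<rho>(2) \<open>s > 0\<close> by (simp add: mult_pos_neg)
      ultimately show "\<exists>y. (q has_real_derivative y) (at a) \<and> y < 0" by blast
    qed
    then have "\<Phi> (s *\<^sub>R (w + e *\<^sub>R h)) < \<Phi> (s *\<^sub>R w)"
      by (simp add: q_def algebra_simps)
    also have "\<dots> \<le> \<Phi> w" using ray(4)[of s] s \<delta> by simp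
    finally show False using min[OF s(3)] by simp
  qed
  then have "blinfun_apply (\<Phi>' w) = (\<lambda>_. 0)" by (simp add: fun_eq_iff)
  then show ?thesis using deriv[of w] by (simp add: critical_point_def)
qed

end

theorem corollary3p2:
  fixes P \<Upsilon> \<Gamma> \<Phi> J :: "'a::banach \<Rightarrow> real"
    and \<upsilon> \<kappa> \<gamma> C c :: real
    and Y\<^sub>1 Y\<^sub>2 :: "'a set"
  assumes reflexive: "reflexive_space TYPE('a)"
    and exponents: "0 < \<upsilon>" "\<upsilon> < \<kappa>" "\<kappa> < \<gamma>"
    and C1: "C1_functional P" "C1_functional \<Upsilon>" "C1_functional \<Gamma>"
    and wlsc: "weakly_lsc P" "weakly_lsc \<Upsilon>" "weakly_lsc \<Gamma>"
    and homogeneity: "homogeneous \<kappa> P" "homogeneous \<upsilon> \<Upsilon>" "homogeneous \<gamma> \<Gamma>"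
    and C_pos: "C > 0"
    and P_bound: "\<And>u. P u \<ge> inverse C * norm u powr \<kappa>"
    and \<Upsilon>_bound: "\<And>u. \<bar>\<Upsilon> u\<bar> \<le> C * norm u powr \<upsilon>"
    and \<Gamma>_bound: "\<And>u. \<bar>\<Gamma> u\<bar> \<le> C * norm u powr \<gamma>"
    and \<Phi>_eq: "\<Phi> = (\<lambda>u. 1/\<kappa> * P u + 1/\<upsilon> * \<Upsilon> u + 1/\<gamma> * \<Gamma> u)"
    and J_eq: "J = radial_derivative \<Phi>"
    and Y1_eq: "Y\<^sub>1 = {u. \<Upsilon> u < 0}"
    and Y2_eq: "Y\<^sub>2 = {u. \<Gamma> u < 0}"
    and compactness: "\<And>Y x u. Y \<in> {Y\<^sub>1, Y\<^sub>2} \<Longrightarrow> (\<And>n. x n \<in> Y) \<Longrightarrow>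
      weakly_converges x u \<Longrightarrow> (\<lambda>n. J (x n)) \<longlonglongrightarrow> J u \<Longrightarrow> x \<longlonglongrightarrow> u"
    and fibering: "\<And>u. u \<in> Y\<^sub>1 \<inter> Y\<^sub>2 \<Longrightarrow>
      \<exists>t s. 0 < t \<and> t < s \<and>
        {r. r > 0 \<and> critical_point (\<lambda>r. \<Phi> (r *\<^sub>R u)) r} = {t, s} \<and>
        nondegenerate (\<lambda>r. \<Phi> (r *\<^sub>R u)) t \<and> nondegenerate (\<lambda>r. \<Phi> (r *\<^sub>R u)) s \<and>
        local_minimizer (\<lambda>r. \<Phi> (r *\<^sub>R u)) t \<and> local_maximizer (\<lambda>r. \<Phi> (r *\<^sub>R u)) s"
    and Y1_nonempty: "Y\<^sub>1 \<noteq> {}"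
    and c_eq: "c = (INF u \<in> nehari \<Phi> \<inter> Y\<^sub>1. \<Phi> u)"
  shows "nehari \<Phi> \<inter> Y\<^sub>1 \<noteq> {} \<and> bdd_below (\<Phi> ` (nehari \<Phi> \<inter> Y\<^sub>1)) \<and>
    c < 0 \<and> ground_state_level \<Phi> c \<and>
    (\<exists>u \<in> nehari \<Phi> \<inter> Y\<^sub>1. \<Phi> u = c \<and> local_minimizer \<Phi> u \<and>
      (Y\<^sub>2 \<noteq> {} \<longrightarrow> (\<exists>v. v \<noteq> 0 \<and> v \<noteq> u \<and> critical_point \<Phi> v)))"
proof -
  have fib: "\<exists>t s. 0 < t \<and> t < s \<and>
        {r. r > 0 \<and> critical_point (\<lambda>r. \<Phi> (r *\<^sub>R u)) r} = {t, s} \<and>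
        local_minimizer (\<lambda>r. \<Phi> (r *\<^sub>R u)) t" if "\<Upsilon> u < 0" "\<Gamma> u < 0" for u
    using fibering[of u] that unfolding Y1_eq Y2_eq by blast
  interpret H: homogeneous_sum P \<Upsilon> \<Gamma> \<kappa> \<upsilon> \<gamma> C
    by unfold_locales (fact exponents C1 homogeneity C_pos P_bound \<Upsilon>_bound \<Gamma>_bound)+
  have \<Phi>: "H.\<Phi> = \<Phi>"
    by (simp add: \<Phi>_eq fun_eq_iff H.\<Phi>_def)
  interpret H: fibered_sum P \<Upsilon> \<Gamma> \<kappa> \<upsilon> \<gamma> C
    by unfold_locales (use reflexive wlsc fib in \<open>simp_all add: \<Phi>\<close>)
  have nehari: "u \<in> nehari \<Phi> \<longleftrightarrow> u \<noteq> 0 \<and> H.J u = 0" for u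
    using H.radial_derivative_\<Phi>[of u] by (simp add: nehari_def \<Phi>)
  have crit_nehari: "v \<in> nehari \<Phi>" if "v \<noteq> 0" "critical_point \<Phi> v" for v
  proof -
    have "frechet_derivative \<Phi> (at v) = (\<lambda>_. 0)"
      using that(2) unfolding critical_point_def by (rule frechet_derivative_at[symmetric])
    then show ?thesis using that(1) by (simp add: nehari_def radial_derivative_def)
  qed
  obtain v0 where "\<Upsilon> v0 < 0" using Y1_nonempty Y1_eq by blast
  then obtain u \<sigma> where u: "H.J u = 0" "\<Upsilon> u < 0" "\<Phi> u < 0"
      "\<And>w. H.J w = 0 \<Longrightarrow> \<Upsilon> w < 0 \<Longrightarrow> \<Phi> u \<le> \<Phi> w"
    and min: "local_minimizer \<Phi> u" and \<sigma>: "\<sigma> > 1" "H.J (\<sigma> *\<^sub>R u) > 0"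
    using H.ground_state_minimizer unfolding \<Phi> by blast
  have u0: "u \<noteq> 0" using u(2) H.zero_values by auto
  have mem: "u \<in> nehari \<Phi> \<inter> Y\<^sub>1" using u u0 by (simp add: nehari Y1_eq)
  have le: "\<Phi> u \<le> \<Phi> w" if "w \<in> nehari \<Phi> \<inter> Y\<^sub>1" for w
    using that u(4) by (simp add: nehari Y1_eq)
  have c: "\<Phi> u = c"
    unfolding c_eq using mem le by (intro cInf_eq_minimum[symmetric]) auto
  have bdd: "bdd_below (\<Phi> ` (nehari \<Phi> \<inter> Y\<^sub>1))"
    using le by (intro bdd_belowI2) blast
  obtain \<Phi>' :: "'a \<Rightarrow> 'a \<Rightarrow>\<^sub>L real" where "(\<Phi> has_derivative \<Phi>' u) (at u)"
    using H.\<Phi>_C1 unfolding \<Phi> by blast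
  moreover have "\<forall>\<^sub>F w in at u. \<Phi> u \<le> \<Phi> w"
    using min unfolding local_minimizer_def eventually_at_filter by (rule eventually_mono) simp
  ultimately have crit: "critical_point \<Phi> u"
    unfolding critical_point_def using has_derivative_local_min[of \<Phi> "\<Phi>' u" u] by simp
  have "\<Phi> u \<le> \<Phi> v" if v: "v \<noteq> 0" "critical_point \<Phi> v" for v
  proof (cases "\<Upsilon> v < 0")
    case True
    then show ?thesis using crit_nehari[OF v] by (intro le) (simp add: Y1_eq)
  next
    case False
    then show ?thesis
      using H.\<Phi>_pos_on_nehari[of v] crit_nehari[OF v] u(3) by (simp add: nehari \<Phi>)
  qed
  then have ground: "ground_state_level \<Phi> c"
    using u0 crit c unfolding ground_state_level_def ground_state_def by blast
  have second: "\<exists>v. v \<noteq> 0 \<and> v \<noteq> u \<and> critical_point \<Phi> v" if "Y\<^sub>2 \<noteq> {}"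
  proof -
    obtain v0 where "\<Gamma> v0 < 0" using \<open>Y\<^sub>2 \<noteq> {}\<close> Y2_eq by blast
    then obtain w where w: "w \<in> H.falling_nehari"
        "\<And>v. v \<in> H.falling_nehari \<Longrightarrow> H.\<Phi> w \<le> H.\<Phi> v"
      using H.falling_nehari_minimizer by blast
    have "critical_point \<Phi> w"
      using H.falling_nehari_minimizer_critical[OF w] by (simp add: \<Phi>)
    moreover have "w \<noteq> 0" using w(1) H.zero_values by (auto simp: H.falling_nehari_def)
    moreover have "w \<noteq> u"
    proof
      assume "w = u"
      then have "H.J (\<sigma> *\<^sub>R u) \<le> 0" using w(1) \<sigma>(1) by (simp add: H.falling_nehari_def)
      with \<sigma>(2) show False by simp
    qed
    ultimately show ?thesis by blast
  qed
  show ?thesis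
    using mem bdd u(3) c ground min second by blast
qed

end
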